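(* Let $n,k,t,q$ be integers with $q>2$, $n\ge k>t\ge 1$, $n>(t+1)(k-t+1)$ and $q\ge t+1$; if $t=1$, assume in addition that $n>3k-2$. Then $\mathcal F_q(t,k,n)$ is the unique maximum size $(t,k)_q$-intersecting family of words of length $n$, up to equivalence; that is, $\mathcal F_q(t,k,n)$ has the maximum size among all $(t,k)_q$-intersecting families of words of length $n$, and every $(t,k)_q$-intersecting family of words of length $n$ of this maximum size is equivalent to $\mathcal F_q(t,k,n)$.
   Context: $\mathbb Z_q=\{0,1,\dots,q-1\}$ is the alphabet. The weight $\mathrm{wt}(x)$ of a word $x=(x_1,\dots,x_n)\in\mathbb Z_q^n$ is the number of indices $i$ with $x_i\ne 0$. A $(t,k)_q$-intersecting family (of length $n$) is a set of words of length $n$ and weight $k$ over $\mathbb Z_q$ such that for any two words $x,y$ in the set, $|\{i : 1\le i\le n,\ x_i=y_i \text{ and } x_i\neq 0\}|\ge t$. $\mathcal F_q(t,k,n)$ is the set of all words of length $n$ over $\mathbb Z_q$ of the form $(1,\dots,1,b_1,\dots,b_{n-t})$, starting with $t$ ones, where $b_i\in\mathbb Z_q$ and $\mathrm{wt}(b_1,\dots,b_{n-t})=k-t$. Two sets of words of length $n$ and constant weight $k$ over $\mathbb Z_q$ are equivalent if one is obtained from the other by a permutation of the $n$ coordinates together with, in each coordinate separately, a permutation of the symbols of $\mathbb Z_q$ fixing $0$. *)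

theory Defs
  imports "HOL-Combinatorics.Permutations"
begin

text \<open>Words of length \<open>n\<close> over \<open>{0, ..., q - 1}\<close> are lists of naturals; coordinates are
  counted from \<open>0\<close>.\<close>

definition words :: "nat \<Rightarrow> nat \<Rightarrow> nat list set" where
  "words q n = {x. length x = n \<and> set x \<subseteq> {..<q}}"

definition wt :: "nat list \<Rightarrow> nat" where
  "wt x = card {i. i < length x \<and> x ! i \<noteq> 0}"

definition intersecting_family :: "nat \<Rightarrow> nat \<Rightarrow> nat \<Rightarrow> nat \<Rightarrow> nat list set \<Rightarrow> bool" where
  "intersecting_family q t k n A \<longleftrightarrow>
     A \<subseteq> {x \<in> words q n. wt x = k} \<and>
     (\<forall>x\<in>A. \<forall>y\<in>A. t \<le> card {i. i < n \<and> x ! i = y ! i \<and> x ! i \<noteq> 0})"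

definition canonical_family :: "nat \<Rightarrow> nat \<Rightarrow> nat \<Rightarrow> nat \<Rightarrow> nat list set" where
  "canonical_family q t k n =
     {replicate t 1 @ b |b. b \<in> words q (n - t) \<and> wt b = k - t}"

definition equivalent :: "nat \<Rightarrow> nat \<Rightarrow> nat list set \<Rightarrow> nat list set \<Rightarrow> bool" where
  "equivalent q n A B \<longleftrightarrow>
     (\<exists>\<pi> \<sigma>. \<pi> permutes {..<n} \<and>
        (\<forall>i<n. \<sigma> i permutes {..<q} \<and> \<sigma> i 0 = 0) \<and>
        B = (\<lambda>x. map (\<lambda>i. \<sigma> i (x ! \<pi> i)) [0..<n]) ` A)"

text \<open>Families are finite, so comparing their sizes by \<^const>\<open>card\<close> is meaningful.\<close>

lemma finite_words: "finite (words q n)"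
  using finite_lists_length_eq[of "{..<q}" n] by (simp add: words_def conj_commute)

lemma finite_intersecting_family: "intersecting_family q t k n A \<Longrightarrow> finite A"
  unfolding intersecting_family_def by (rule finite_subset[OF _ finite_words[of q n]]) auto

end

theory Submission
  imports Defs
begin

text \<open>A word of weight \<open>k\<close> is the set of the pairs \<open>(i, s)\<close> of a coordinate \<open>i\<close> and the nonzero
symbol \<open>s\<close> standing there, and the agreement counted in the definition of an intersecting family
is the size of the intersection of two such sets.  Call the family of all words containing a fixed
\<open>t\<close>-set of pairs a star; the canonical family is one, and all stars are equivalent
(\<open>star_equivalent_canonical\<close>).  It remains to see that a family of maximum size is a star.

The proof compresses twice.  Shifting the symbols \<open>s \<ge> 2\<close> to the symbol \<open>1\<close>, one
coordinate and one symbol at a time, keeps the size and the intersection property, and in a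
family that no such shift changes, any two words already agree in \<open>t\<close> coordinates where both
have the symbol \<open>1\<close> (\<open>t_intersecting_ones\<close>).  So only the sets of the coordinates with symbol \<open>1\<close>
matter: a \<open>t\<close>-intersecting family of sets \<open>J\<close> of size at most \<open>k\<close>, in which \<open>J\<close> counts with the
number of words whose ones are exactly \<open>J\<close>.  This weight depends on the size \<open>j\<close> of \<open>J\<close> only, and it
falls by a factor of more than \<open>t\<close> with every element beyond the \<open>t\<close>-th
(\<open>ones_weight_decay\<close>).  This is the discrete form of the condition \<open>p < 1 / (t + 1)\<close>
for the \<open>p\<close>-biased measure, and the Ahlswede--Khachatrian argument for that measure applies:
after a second compression, now to the left, the last coordinate on which the family depends can be
deleted from some of its sets, and the gain is larger than the loss unless the family is a star
(\<open>shifted_maximum_is_star\<close>).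

For uniqueness, both compressions are undone one step at a time: if a shift turns a
\<open>t\<close>-intersecting family into a star, then the family was a star before
(\<open>star_if_shift_star\<close>).  This needs room for a word that meets two given words of the star only in
its centre, and in the first compression \<open>3 * k \<le> n + 2 * t\<close> provides it; for \<open>t = 1\<close> this is the
additional hypothesis of the theorem, and for \<open>t \<ge> 2\<close> it follows from the main bound on \<open>n\<close>.\<close>

section \<open>Shifting families of sets\<close>

definition t_intersecting :: "nat \<Rightarrow> 'a set set \<Rightarrow> bool" where
  "t_intersecting t F \<longleftrightarrow> (\<forall>X\<in>F. \<forall>Y\<in>F. t \<le> card (X \<inter> Y))"

definition star :: "'a set set \<Rightarrow> 'a set \<Rightarrow> 'a set set" where
  "star U T = {X\<in>U. T \<subseteq> X}"

definition weight :: "(nat \<Rightarrow> nat) \<Rightarrow> 'a set set \<Rightarrow> nat" where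
  "weight w F = (\<Sum>X\<in>F. w (card X))"

definition swap_in :: "'a \<Rightarrow> 'a \<Rightarrow> 'a set \<Rightarrow> 'a set" where
  "swap_in a b X = (if b \<in> X \<and> a \<notin> X then insert a (X - {b}) else X)"

definition shift_elem :: "'a \<Rightarrow> 'a \<Rightarrow> 'a set set \<Rightarrow> 'a set \<Rightarrow> 'a set" where
  "shift_elem a b F X = (if swap_in a b X \<in> F then X else swap_in a b X)"

definition shift :: "'a \<Rightarrow> 'a \<Rightarrow> 'a set set \<Rightarrow> 'a set set" where
  "shift a b F = shift_elem a b F ` F"

lemma t_intersectingD: "t_intersecting t F \<Longrightarrow> X \<in> F \<Longrightarrow> Y \<in> F \<Longrightarrow> t \<le> card (X \<inter> Y)"
  by (simp add: t_intersecting_def)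

lemma t_intersecting_Un:
  assumes "t_intersecting t A" "t_intersecting t B"
    and cross: "\<And>X Y. X \<in> A \<Longrightarrow> Y \<in> B \<Longrightarrow> t \<le> card (X \<inter> Y)"
  shows "t_intersecting t (A \<union> B)"
proof -
  have "t \<le> card (Y \<inter> X)" if "X \<in> A" "Y \<in> B" for X Y
    using cross[OF that] by (simp add: Int_commute)
  then show ?thesis using assms by (auto simp: t_intersecting_def)
qed

lemma t_intersecting_star:
  assumes "\<And>X. X \<in> U \<Longrightarrow> finite X"
  shows "t_intersecting (card T) (star U T)"
  unfolding t_intersecting_def star_def
  by (auto intro!: card_mono simp: assms)

lemma card_swap_in: "finite X \<Longrightarrow> card (swap_in a b X) = card X"
  using card_Suc_Diff1[of X b] by (auto simp: swap_in_def)

lemma swap_in_cancel: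
  assumes "b \<in> X" "a \<notin> X" "b \<in> Y" "a \<notin> Y" "swap_in a b X = swap_in a b Y"
  shows "X = Y"
proof -
  have "X = insert b (swap_in a b X - {a})" "Y = insert b (swap_in a b Y - {a})"
    using assms(1-4) by (auto simp: swap_in_def)
  then show ?thesis using assms(5) by simp
qed

lemma inj_on_shift_elem: "inj_on (shift_elem a b F) F"
proof (rule inj_onI)
  fix X Y assume XY: "X \<in> F" "Y \<in> F" and eq: "shift_elem a b F X = shift_elem a b F Y"
  show "X = Y"
  proof (cases "swap_in a b X \<in> F \<or> swap_in a b Y \<in> F")
    case True
    then show ?thesis using eq XY by (auto simp: shift_elem_def split: if_splits)
  next
    case False
    then have "b \<in> X" "a \<notin> X" "b \<in> Y" "a \<notin> Y"
      using XY by (auto simp: swap_in_def split: if_splits)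
    moreover have "swap_in a b X = swap_in a b Y"
      using eq False by (simp add: shift_elem_def)
    ultimately show ?thesis by (rule swap_in_cancel)
  qed
qed

text \<open>Shifting moves elements but never merges two members of a family, and it keeps the size of every member.\<close>

lemma weight_shift:
  assumes "\<And>X. X \<in> F \<Longrightarrow> finite X"
  shows "weight w (shift a b F) = weight w F"
proof -
  have "weight w (shift a b F) = (\<Sum>X\<in>F. w (card (shift_elem a b F X)))"
    unfolding weight_def shift_def by (simp add: sum.reindex[OF inj_on_shift_elem])
  also have "\<dots> = weight w F"
    unfolding weight_def by (rule sum.cong) (auto simp: shift_elem_def card_swap_in assms)
  finally show ?thesis .
qed

text \<open>The delicate pair is a member that moves, having lost \<open>b\<close>, and a member \<open>Y\<close> that contains \<open>b\<close> and stays.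
If \<open>Y\<close> also contains \<open>a\<close>, the loss of \<open>b\<close> is made up for; otherwise \<open>Y\<close> stays because its own image lies
in the family already, and intersecting with that image gives the bound.\<close>

lemma t_intersecting_shift:
  assumes int: "t_intersecting t F" and fin: "\<And>X. X \<in> F \<Longrightarrow> finite X"
  shows "t_intersecting t (shift a b F)"
proof -
  have one: "t \<le> card (swap_in a b X \<inter> Y)"
    if X: "X \<in> F" "swap_in a b X \<notin> F" and Y: "Y \<in> F" "swap_in a b Y \<in> F" for X Y
  proof -
    have b: "b \<in> X" "a \<notin> X"
      using X by (auto simp: swap_in_def split: if_splits)
    then have sX: "swap_in a b X = insert a (X - {b})" by (simp add: swap_in_def)
    have finX: "finite X" using fin X by auto
    consider "b \<notin> Y" | "a \<in> Y" "b \<in> Y" | "b \<in> Y" "a \<notin> Y" by auto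
    then show ?thesis
    proof cases
      case 1
      then have "X \<inter> Y \<subseteq> swap_in a b X \<inter> Y" using sX by auto
      then have "card (X \<inter> Y) \<le> card (swap_in a b X \<inter> Y)"
        using finX sX by (intro card_mono) auto
      then show ?thesis using t_intersectingD[OF int X(1) Y(1)] by simp
    next
      case 2
      then have "swap_in a b X \<inter> Y = insert a (X \<inter> Y - {b})" using sX by auto
      then have "card (swap_in a b X \<inter> Y) = card (X \<inter> Y)"
        using b 2 finX card_Suc_Diff1[of "X \<inter> Y" b] by simp
      then show ?thesis using t_intersectingD[OF int X(1) Y(1)] by simp
    next
      case 3
      then have "swap_in a b X \<inter> Y = X \<inter> swap_in a b Y"
        using sX b by (auto simp: swap_in_def)
      then show ?thesis using t_intersectingD[OF int X(1) Y(2)] by simp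
    qed
  qed
  have two: "t \<le> card (swap_in a b X \<inter> swap_in a b Y)"
    if X: "X \<in> F" "swap_in a b X \<notin> F" and Y: "Y \<in> F" "swap_in a b Y \<notin> F" for X Y
  proof -
    have b: "b \<in> X" "a \<notin> X" "b \<in> Y" "a \<notin> Y"
      using X Y by (auto simp: swap_in_def split: if_splits)
    then have "swap_in a b X \<inter> swap_in a b Y = swap_in a b (X \<inter> Y)"
      by (auto simp: swap_in_def)
    then show ?thesis
      using t_intersectingD[OF int X(1) Y(1)] fin[OF X(1)] by (simp add: card_swap_in)
  qed
  have "t \<le> card (shift_elem a b F X \<inter> shift_elem a b F Y)" if XY: "X \<in> F" "Y \<in> F" for X Y
  proof -
    consider "swap_in a b X \<in> F" "swap_in a b Y \<in> F" | "swap_in a b X \<in> F" "swap_in a b Y \<notin> F"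
      | "swap_in a b X \<notin> F" "swap_in a b Y \<in> F" | "swap_in a b X \<notin> F" "swap_in a b Y \<notin> F"
      by blast
    then show ?thesis
    proof cases
      case 1
      then show ?thesis using t_intersectingD[OF int XY] by (simp add: shift_elem_def)
    next
      case 2
      then show ?thesis using one[OF XY(2) _ XY(1)] by (simp add: shift_elem_def Int_commute)
    next
      case 3
      then show ?thesis using one[OF XY(1) _ XY(2)] by (simp add: shift_elem_def)
    next
      case 4
      then show ?thesis using two[OF XY(1) _ XY(2)] by (simp add: shift_elem_def)
    qed
  qed
  then show ?thesis by (auto simp: t_intersecting_def shift_def)
qed

lemma shift_subset:
  assumes "F \<subseteq> U" "\<And>X. X \<in> U \<Longrightarrow> swap_in a b X \<in> U"
  shows "shift a b F \<subseteq> U"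
  using assms by (auto simp: shift_def shift_elem_def)

text \<open>The potential that makes repeated shifting terminate.\<close>

lemma sum_shift_less:
  fixes r :: "'a \<Rightarrow> nat"
  assumes "finite F" and fin: "\<And>X. X \<in> F \<Longrightarrow> finite X" and r: "r a < r b"
    and X: "X \<in> F" "swap_in a b X \<notin> F"
  shows "(\<Sum>X\<in>shift a b F. \<Sum>x\<in>X. r x) < (\<Sum>X\<in>F. \<Sum>x\<in>X. r x)"
proof -
  have less: "(\<Sum>x\<in>swap_in a b Y. r x) < (\<Sum>x\<in>Y. r x)" if "Y \<in> F" "swap_in a b Y \<notin> F" for Y
  proof -
    have b: "b \<in> Y" "a \<notin> Y"
      using that by (auto simp: swap_in_def split: if_splits)
    then show ?thesis
      using fin[OF that(1)] r by (simp add: swap_in_def sum.remove[of Y b])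
  qed
  have "(\<Sum>X\<in>shift a b F. \<Sum>x\<in>X. r x) = (\<Sum>X\<in>F. \<Sum>x\<in>shift_elem a b F X. r x)"
    unfolding shift_def by (simp add: sum.reindex[OF inj_on_shift_elem])
  also have "\<dots> < (\<Sum>X\<in>F. \<Sum>x\<in>X. r x)"
  proof (rule sum_strict_mono_ex1)
    show "\<forall>Y\<in>F. (\<Sum>x\<in>shift_elem a b F Y. r x) \<le> (\<Sum>x\<in>Y. r x)"
      using less by (auto simp: shift_elem_def intro: less_imp_le)
    show "\<exists>Y\<in>F. (\<Sum>x\<in>shift_elem a b F Y. r x) < (\<Sum>x\<in>Y. r x)"
      using less X by (intro bexI[of _ X]) (auto simp: shift_elem_def)
  qed fact
  finally show ?thesis .
qed

text \<open>Undoing one shift.  Every set of the star comes from itself or from its preimage under the swap.  If both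
cases occurred away from the sets containing \<open>a\<close> and \<open>b\<close>, say with \<open>X1\<close> kept and \<open>Y0\<close> moved, then
a set \<open>Z\<close> of the star meeting each of them only inside \<open>T\<close> could be neither: as a kept set it would
meet the preimage of \<open>Y0\<close> in less than \<open>t\<close> elements, and its preimage would meet \<open>X1\<close> in less than \<open>t\<close> elements.
So either nothing moved or everything did, and the family is the star of \<open>T\<close> or of \<open>T\<close> with \<open>b\<close> in place of \<open>a\<close>.\<close>

lemma star_if_shift_star:
  assumes FU: "F \<subseteq> U" and int: "t_intersecting t F" and fin: "\<And>X. X \<in> U \<Longrightarrow> finite X"
    and closed: "\<And>X. X \<in> U \<Longrightarrow> swap_in a b X \<in> U"
    and card: "card T = t" and st: "shift a b F = star U T"
    and sep: "\<And>X Y. \<lbrakk>a \<in> T; b \<notin> T; X \<in> star U T; Y \<in> star U T; b \<notin> X; b \<notin> Y\<rbrakk> \<Longrightarrow>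
      \<exists>Z\<in>star U T. b \<notin> Z \<and> X \<inter> Z \<subseteq> T \<and> Y \<inter> Z \<subseteq> T"
  shows "\<exists>T'. card T' = t \<and> F = star U T'"
proof -
  have image: "X \<in> star U T \<longleftrightarrow> (\<exists>Y\<in>F. X = shift_elem a b F Y)" for X
    using st by (auto simp: shift_def)
  show ?thesis
  proof (cases "F \<subseteq> star U T")
    case True
    have "X \<in> F" if X: "X \<in> star U T" for X
    proof -
      obtain Y where Y: "Y \<in> F" "X = shift_elem a b F Y" using X image by auto
      obtain Z where Z: "Z \<in> F" "Y = shift_elem a b F Z" using Y True image by blast
      show ?thesis
        using Y Z by (auto simp: shift_elem_def swap_in_def split: if_splits)
    qed
    then show ?thesis using True card by blast
  next
    case False
    then obtain X0 where X0: "X0 \<in> F" "X0 \<notin> star U T" by blast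
    define Y0 where "Y0 = swap_in a b X0"
    have "shift_elem a b F X0 \<in> star U T" using X0 image by blast
    then have Y0: "Y0 \<in> star U T" "Y0 \<noteq> X0"
      using X0 by (auto simp: shift_elem_def Y0_def split: if_splits)
    then have b0: "b \<in> X0" "a \<notin> X0" and Y0_eq: "Y0 = insert a (X0 - {b})"
      by (auto simp: Y0_def swap_in_def split: if_splits)
    then have ab: "a \<noteq> b" and bY0: "b \<notin> Y0" by auto
    have aT: "a \<in> T" using X0 FU Y0 Y0_eq by (auto simp: star_def)
    have bT: "b \<notin> T" using Y0 bY0 by (auto simp: star_def)
    have finT: "finite T" using Y0 fin by (auto simp: star_def intro: finite_subset)
    have small: "\<not> t \<le> card S" if "S \<subseteq> T - {a}" for S
    proof -
      have "card S \<le> card (T - {a})" using that finT by (intro card_mono) auto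
      also have "\<dots> < t" using aT finT card by (metis card_Diff1_less)
      finally show ?thesis by simp
    qed
    have excl: "b \<in> X1" if X1: "X1 \<in> F" "T \<subseteq> X1" for X1
    proof (rule ccontr)
      assume bX1: "b \<notin> X1"
      have "X1 \<in> star U T" using X1 FU by (auto simp: star_def)
      from sep[OF aT bT this Y0(1) bX1 bY0] obtain Z where
        Z: "Z \<in> star U T" "b \<notin> Z" "X1 \<inter> Z \<subseteq> T" "Y0 \<inter> Z \<subseteq> T" by blast
      obtain Z' where Z': "Z' \<in> F" "Z = shift_elem a b F Z'" using Z image by auto
      show False
      proof (cases "Z = Z'")
        case True
        have "Z \<inter> X0 \<subseteq> T - {a}" using Z Y0_eq b0 by auto
        then show False using small t_intersectingD[OF int] True Z' X0 by blast
      next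
        case False
        then have "Z = insert a (Z' - {b})"
          using Z' by (auto simp: shift_elem_def swap_in_def split: if_splits)
        moreover have "a \<notin> Z'"
          using Z' False by (auto simp: shift_elem_def swap_in_def split: if_splits)
        ultimately have "X1 \<inter> Z' \<subseteq> T - {a}" using Z bX1 by auto
        then show False using small t_intersectingD[OF int X1(1) Z'(1)] by blast
      qed
    qed
    \<comment> \<open>Every set that could move did move, so the centre moves along.\<close>
    define T' where "T' = insert b (T - {a})"
    have "card T' = t"
      unfolding T'_def using aT bT finT card card_Suc_Diff1[of T a] by simp
    moreover have "F = star U T'"
    proof (intro equalityI subsetI)
      fix X assume X: "X \<in> F"
      have "T' \<subseteq> X"
      proof (cases "T \<subseteq> X")
        case True
        then show ?thesis using excl[OF X] by (auto simp: T'_def)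
      next
        case False
        have "T \<subseteq> shift_elem a b F X" using X image by (auto simp: star_def)
        then show ?thesis
          using False by (auto simp: T'_def shift_elem_def swap_in_def split: if_splits)
      qed
      then show "X \<in> star U T'" using X FU by (auto simp: star_def)
    next
      fix Y assume Y: "Y \<in> star U T'"
      then have bY: "b \<in> Y" and YU: "Y \<in> U" by (auto simp: star_def T'_def)
      have "swap_in a b Y \<in> star U T"
        using Y closed[OF YU] bT by (auto simp: star_def T'_def swap_in_def)
      then obtain X where X: "X \<in> F" "swap_in a b Y = shift_elem a b F X"
        using image by auto
      have TX: "T \<subseteq> swap_in a b Y" using \<open>swap_in a b Y \<in> star U T\<close> by (simp add: star_def)
      show "Y \<in> F"
      proof (cases "a \<in> Y")
        case True
        then have "swap_in a b Y = Y" by (simp add: swap_in_def)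
        moreover have "swap_in a b X \<noteq> Y \<or> X = Y"
          using bY True ab by (auto simp: swap_in_def)
        ultimately show ?thesis using X by (auto simp: shift_elem_def split: if_splits)
      next
        case False
        have nb: "b \<notin> swap_in a b Y" using False bY ab by (auto simp: swap_in_def)
        then have "X \<noteq> swap_in a b Y" using excl[OF X(1)] TX by auto
        then have eq: "swap_in a b Y = swap_in a b X"
          using X by (auto simp: shift_elem_def split: if_splits)
        with \<open>X \<noteq> swap_in a b Y\<close> have "b \<in> X" "a \<notin> X"
          by (auto simp: swap_in_def split: if_splits)
        with eq bY False have "Y = X" by (metis swap_in_cancel)
        then show ?thesis using X by simp
      qed
    qed
    ultimately show ?thesis by blast
  qed
qed

text \<open>The form in which shifting is used in both compressions: for a class of families that is given by \<open>t\<close>-intersection and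
a prescribed weight, it is enough to recognise the families unchanged by the shifts in \<open>S\<close> as stars.\<close>

lemma star_if_stable_star:
  fixes r :: "'a \<Rightarrow> nat" and w :: "nat \<Rightarrow> nat"
  assumes finU: "finite U" and fin: "\<And>X. X \<in> U \<Longrightarrow> finite X"
    and r: "\<And>a b. (a, b) \<in> S \<Longrightarrow> r a < r b"
    and closed: "\<And>a b X. (a, b) \<in> S \<Longrightarrow> X \<in> U \<Longrightarrow> swap_in a b X \<in> U"
    and sep: "\<And>a b T X Y. \<lbrakk>(a, b) \<in> S; card T = t; a \<in> T; b \<notin> T;
        X \<in> star U T; Y \<in> star U T; b \<notin> X; b \<notin> Y\<rbrakk> \<Longrightarrow>
      \<exists>Z\<in>star U T. b \<notin> Z \<and> X \<inter> Z \<subseteq> T \<and> Y \<inter> Z \<subseteq> T"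
    and stable: "\<And>G. \<lbrakk>G \<subseteq> U; t_intersecting t G; weight w G = M;
        \<And>a b X. (a, b) \<in> S \<Longrightarrow> X \<in> G \<Longrightarrow> swap_in a b X \<in> G\<rbrakk> \<Longrightarrow>
      \<exists>T. card T = t \<and> G = star U T"
    and "F \<subseteq> U" "t_intersecting t F" "weight w F = M"
  shows "\<exists>T. card T = t \<and> F = star U T"
  using assms(7-)
proof (induction "\<Sum>X\<in>F. \<Sum>x\<in>X. r x" arbitrary: F rule: less_induct)
  case less
  have finF: "finite F" using less.prems finU finite_subset by blast
  have finX: "finite X" if "X \<in> F" for X using that less.prems fin by blast
  show ?case
  proof (cases "\<exists>a b X. (a, b) \<in> S \<and> X \<in> F \<and> swap_in a b X \<notin> F")
    case False
    then show ?thesis using stable less.prems by blast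
  next
    case True
    then obtain a b X where ab: "(a, b) \<in> S" and X: "X \<in> F" "swap_in a b X \<notin> F" by blast
    have "\<exists>T. card T = t \<and> shift a b F = star U T"
    proof (rule less.hyps)
      show "(\<Sum>X\<in>shift a b F. \<Sum>x\<in>X. r x) < (\<Sum>X\<in>F. \<Sum>x\<in>X. r x)"
        using finF finX r[OF ab] X by (rule sum_shift_less)
      show "shift a b F \<subseteq> U" using less.prems(1) closed[OF ab] by (rule shift_subset)
      show "t_intersecting t (shift a b F)"
        using less.prems(2) finX by (rule t_intersecting_shift)
      show "weight w (shift a b F) = M" using weight_shift[OF finX] less.prems(3) by simp
    qed
    then obtain T where T: "card T = t" "shift a b F = star U T" by blast
    show ?thesis
      using less.prems(1,2) fin closed[OF ab] T sep[OF ab T(1)] by (rule star_if_shift_star)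
  qed
qed

section \<open>Weighted families of subsets of bounded size\<close>

definition small_sets :: "nat \<Rightarrow> nat \<Rightarrow> nat set set" where
  "small_sets n k = {J. J \<subseteq> {..<n} \<and> card J \<le> k}"

lemma finite_small_sets: "finite (small_sets n k)"
  by (rule finite_subset[of _ "Pow {..<n}"]) (auto simp: small_sets_def)

lemma finite_in_small_sets: "J \<in> small_sets n k \<Longrightarrow> finite J"
  using finite_subset[of J "{..<n}"] by (simp add: small_sets_def)

lemma small_sets_mono: "J \<in> small_sets n k \<Longrightarrow> I \<subseteq> J \<Longrightarrow> I \<in> small_sets n k"
  using card_mono[OF finite_in_small_sets, of J n k I] by (auto simp: small_sets_def)

text \<open>The Ahlswede--Khachatrian pulling argument.  If \<open>F\<close> has a member with \<open>t\<close> elements, then it is the star of that member.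
Suppose that every set of \<open>F\<close> has more than \<open>t\<close> elements.  Let \<open>l\<close> be
the last coordinate whose removal can lead out of \<open>F\<close>, and let \<open>B\<close> consist of the sets for which it does.  Two sets of \<open>B\<close> can
only object to the removal of \<open>l\<close> from one of them if their traces on \<open>{..l}\<close> cover \<open>{..l}\<close> and have exactly \<open>t\<close>
common elements (\<open>key\<close>): otherwise a shift of \<open>l\<close> into an uncovered place would already violate the intersection
property.  So if \<open>l\<close> is removed from the sets in \<open>P \<subseteq> B\<close>, and the conflicting sets \<open>R\<close> are discarded, the family stays
\<open>t\<close>-intersecting, and because the weight increases by a factor of more than \<open>t\<close> for every set in
\<open>P\<close>, maximality forces \<open>t * weight w P < weight w R\<close> (\<open>pull\<close>).

The sizes of conflicting traces add up to \<open>l + 1 + t\<close>.  Two different complementary sizes are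
impossible, since each could be pulled at the expense of the other (\<open>balanced\<close>).  When all traces have the same size
\<open>i\<close> with \<open>2 * i = l + 1 + t\<close>, the sets avoiding a coordinate \<open>a < l\<close> are in conflict with sets containing \<open>a\<close>
only; summing the resulting inequalities over all \<open>a < l\<close> gives \<open>t * (i - t) < i - 1\<close>, which is false for \<open>i > t\<close>.\<close>

lemma shifted_maximum_is_star:
  fixes w :: "nat \<Rightarrow> nat"
  assumes t: "1 \<le> t" "t \<le> k" "t \<le> n"
    and pos: "\<And>j. j \<le> k \<Longrightarrow> 0 < w j"
    and decay: "\<And>j. t < j \<Longrightarrow> j \<le> k \<Longrightarrow> t * w j < w (j - 1)"
    and FU: "F \<subseteq> small_sets n k" and int: "t_intersecting t F"
    and max: "\<And>G. G \<subseteq> small_sets n k \<Longrightarrow> t_intersecting t G \<Longrightarrow> weight w G \<le> weight w F"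
    and shifted: "\<And>i j X. i < j \<Longrightarrow> X \<in> F \<Longrightarrow> swap_in i j X \<in> F"
  shows "\<exists>T. card T = t \<and> F = star (small_sets n k) T"
proof -
  let ?U = "small_sets n k"
  have finF: "finite F" using FU finite_small_sets finite_subset by blast
  have finX: "finite X" if "X \<in> F" for X using that FU finite_in_small_sets by blast
  have card_ge: "t \<le> card X" if "X \<in> F" for X using t_intersectingD[OF int that that] by simp
  have card_le: "card X \<le> k" if "X \<in> F" for X using FU that by (auto simp: small_sets_def)
  \<comment> \<open>Weights are positive, so a maximum family is closed under supersets.\<close>
  have up: "Y \<in> F" if X: "X \<in> F" and Y: "Y \<in> ?U" and XY: "X \<subseteq> Y" for X Y
  proof (rule ccontr)
    assume Yn: "Y \<notin> F"
    have finY: "finite Y" using Y by (rule finite_in_small_sets)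
    have grow: "card (X \<inter> Z) \<le> card (Y \<inter> Z)" for Z
      using XY finY by (intro card_mono) auto
    have "t_intersecting t ({Y} \<union> F)"
    proof (rule t_intersecting_Un)
      have "t \<le> card Y" using card_ge[OF X] card_mono[OF finY XY] by simp
      then show "t_intersecting t {Y}" by (simp add: t_intersecting_def)
      show "t \<le> card (V \<inter> Z)" if "V \<in> {Y}" "Z \<in> F" for V Z
        using t_intersectingD[OF int X that(2)] grow[of Z] that(1) by simp
    qed (rule int)
    moreover have "{Y} \<union> F \<subseteq> ?U" using FU Y by simp
    ultimately have "weight w ({Y} \<union> F) \<le> weight w F" using max by blast
    moreover have "weight w ({Y} \<union> F) = w (card Y) + weight w F"
      using Yn finF by (simp add: weight_def)
    moreover have "0 < w (card Y)" using pos Y by (simp add: small_sets_def)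
    ultimately show False by simp
  qed
  have ne: "F \<noteq> {}"
  proof
    assume "F = {}"
    moreover have "{{..<t}} \<subseteq> ?U" using t by (auto simp: small_sets_def)
    moreover have "t_intersecting t {{..<t}}" by (simp add: t_intersecting_def)
    ultimately have "weight w {{..<t}} \<le> weight w F" using max by blast
    then show False using pos[of t] t \<open>F = {}\<close> by (simp add: weight_def)
  qed
  show ?thesis
  proof (cases "\<exists>T\<in>F. card T = t")
    case True
    then obtain T where T: "T \<in> F" "card T = t" by blast
    have "T \<subseteq> X" if "X \<in> F" for X
    proof -
      have "T \<inter> X = T"
        using t_intersectingD[OF int T(1) that] T finX by (intro card_seteq) auto
      then show ?thesis by blast
    qed
    then have "F = star ?U T" using FU up[OF T(1)] by (auto simp: star_def)
    then show ?thesis using T by blast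
  next
    case False
    then have card_gt: "t < card X" if "X \<in> F" for X
      using card_ge[OF that] that by (metis le_neq_implies_less)
    define L where "L = {l. \<exists>J\<in>F. l \<in> J \<and> J - {l} \<notin> F}"
    have "L \<subseteq> {..<n}" using FU by (auto simp: L_def small_sets_def)
    then have finL: "finite L" using finite_subset by blast
    have "L \<noteq> {}"
    proof -
      obtain J where J: "J \<in> F" "\<And>I. I \<in> F \<Longrightarrow> card J \<le> card I"
        using ne ex_has_least_nat[of "\<lambda>J. J \<in> F" _ card] by blast
      have "J \<noteq> {}" using card_gt[OF J(1)] by auto
      then obtain l where l: "l \<in> J" by blast
      have "J - {l} \<notin> F" using J(2) card_Diff1_less[OF finX[OF J(1)] l] by (meson leD)
      then show ?thesis using l J by (auto simp: L_def)
    qed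
    define l where "l = Max L"
    have lL: "l \<in> L" and l_max: "\<And>d. l < d \<Longrightarrow> d \<notin> L"
      unfolding l_def using finL \<open>L \<noteq> {}\<close> by (auto simp: leD)
    have trace: "X \<inter> {..l} \<in> F" if X: "X \<in> F" for X
    proof -
      have "X - D \<in> F" if "finite D" "D \<subseteq> {l<..}" for D
        using that
      proof (induction D rule: finite_induct)
        case empty
        then show ?case using X by simp
      next
        case (insert d D)
        then have "d \<notin> L" "X - D \<in> F" using l_max by auto
        moreover have "X - insert d D = X - D - {d}" by auto
        ultimately show ?case by (cases "d \<in> X - D") (auto simp: L_def)
      qed
      from this[of "X \<inter> {l<..}"] have "X - X \<inter> {l<..} \<in> F" using finX[OF X] by simp
      moreover have "X - X \<inter> {l<..} = X \<inter> {..l}" by auto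
      ultimately show ?thesis by simp
    qed
    define B where "B = {J\<in>F. l \<in> J \<and> J - {l} \<notin> F}"
    have BF: "B \<subseteq> F" by (auto simp: B_def)
    have Bne: "B \<noteq> {}" using lL by (auto simp: B_def L_def)
    define h where "h J = card (J \<inter> {..l})" for J
    have h_gt: "t < h J" if "J \<in> F" for J unfolding h_def using trace[OF that] card_gt by blast
    have key: "J \<in> B \<and> h J + h E = l + 1 + t \<and> {..l} \<subseteq> J \<union> E"
      if E: "E \<in> B" and J: "J \<in> F" and less: "card (J \<inter> (E - {l})) < t" for J E
    proof -
      let ?E = "E \<inter> {..l}" and ?J = "J \<inter> {..l}"
      have EF: "E \<in> F" using E BF by blast
      have ge: "t \<le> card (?J \<inter> ?E)" using t_intersectingD[OF int trace trace] J EF by blast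
      have lt: "card (?J \<inter> ?E - {l}) < t"
      proof -
        have "card (?J \<inter> ?E - {l}) \<le> card (J \<inter> (E - {l}))"
          using finX[OF J] by (intro card_mono) auto
        then show ?thesis using less by simp
      qed
      have lJE: "l \<in> ?J \<inter> ?E" and eq: "card (?J \<inter> ?E) = t"
      proof -
        show "l \<in> ?J \<inter> ?E" using ge lt by (metis Diff_insert0 Diff_empty leD)
        then show "card (?J \<inter> ?E) = t" using ge lt finX[OF J] by (simp add: card_Diff_singleton)
      qed
      have "J - {l} \<notin> F"
      proof
        assume "J - {l} \<in> F"
        then have "t \<le> card ((J - {l}) \<inter> E)" using t_intersectingD[OF int _ EF] by blast
        moreover have "(J - {l}) \<inter> E = J \<inter> (E - {l})" by blast
        ultimately show False using less by simp
      qed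
      then have JB: "J \<in> B" using J lJE by (auto simp: B_def)
      have cover: "{..l} \<subseteq> J \<union> E"
      proof (rule ccontr)
        assume "\<not> {..l} \<subseteq> J \<union> E"
        then obtain a where a: "a \<le> l" "a \<notin> J" "a \<notin> E" by auto
        then have "a < l" using lJE by (metis IntD1 le_neq_implies_less)
        then have "swap_in a l ?J \<in> F" using shifted trace[OF J] by blast
        then have "t \<le> card (swap_in a l ?J \<inter> ?E)"
          using t_intersectingD[OF int _ trace[OF EF]] by blast
        moreover have "swap_in a l ?J \<inter> ?E = ?J \<inter> ?E - {l}"
          using a lJE by (auto simp: swap_in_def)
        ultimately show False using lt by simp
      qed
      have "card ?J + card ?E = card (?J \<union> ?E) + card (?J \<inter> ?E)"
        using finX[OF J] finX[OF EF] by (intro card_Un_Int) auto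
      moreover have "?J \<union> ?E = {..l}" using cover by auto
      ultimately show ?thesis using JB cover eq by (simp add: h_def)
    qed
    have pull: "t * weight w P < weight w R"
      if P: "P \<subseteq> B" "P \<noteq> {}" and R: "R \<subseteq> F" and PR: "P \<inter> R = {}"
        and big: "\<And>E J. E \<in> P \<Longrightarrow> J \<in> F - R \<Longrightarrow> t \<le> card (J \<inter> (E - {l}))" for P R
    proof -
      let ?P = "(\<lambda>J. J - {l}) ` P"
      have PF: "P \<subseteq> F" using P BF by blast
      have finP: "finite P" using PF finF finite_subset by blast
      have big': "t \<le> card ((J - {l}) \<inter> (E - {l}))" if "E \<in> P" "J \<in> P" for E J
      proof -
        have "(J - {l}) \<inter> (E - {l}) = J \<inter> (E - {l})" by blast
        then show ?thesis using big[OF that(1), of J] that PR PF by auto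
      qed
      have "t_intersecting t (F - R \<union> ?P)"
      proof (rule t_intersecting_Un)
        show "t_intersecting t (F - R)" using int by (auto simp: t_intersecting_def)
        show "t_intersecting t ?P" using big' by (auto simp: t_intersecting_def)
      qed (use big in blast)
      moreover have "F - R \<union> ?P \<subseteq> ?U"
        using FU PF by (auto intro!: small_sets_mono[OF _ Diff_subset])
      ultimately have le: "weight w (F - R \<union> ?P) \<le> weight w F" using max by blast
      have inj: "inj_on (\<lambda>J. J - {l}) P"
      proof (rule inj_onI)
        fix I J assume "I \<in> P" "J \<in> P" "I - {l} = J - {l}"
        moreover from this have "l \<in> I" "l \<in> J" using P by (auto simp: B_def)
        ultimately show "I = J" by (metis insert_Diff)
      qed
      have "?P \<inter> F = {}" using P by (auto simp: B_def)
      then have "weight w (F - R \<union> ?P) = weight w (F - R) + weight w ?P"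
        unfolding weight_def using finF finP by (intro sum.union_disjoint) auto
      moreover have "weight w F = weight w (F - R) + weight w R"
        unfolding weight_def using finF R by (rule sum.subset_diff[rotated])
      ultimately have "weight w ?P \<le> weight w R" using le by simp
      moreover have "t * weight w P < weight w ?P"
      proof -
        have "weight w ?P = (\<Sum>J\<in>P. w (card J - 1))"
          unfolding weight_def sum.reindex[OF inj]
          using P finX PF by (auto intro!: sum.cong simp: B_def card_Diff_singleton)
        moreover have "(\<Sum>J\<in>P. t * w (card J)) < (\<Sum>J\<in>P. w (card J - 1))"
        proof (rule sum_strict_mono)
          fix J assume "J \<in> P"
          then have "J \<in> F" using PF by blast
          then show "t * w (card J) < w (card J - 1)" using decay card_gt card_le by simp
        qed (use finP P in auto)
        ultimately show ?thesis by (simp add: weight_def sum_distrib_left)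
      qed
      ultimately show ?thesis by simp
    qed
    have finB: "finite B" using BF finF finite_subset by blast
    have balanced: "2 * h J = l + 1 + t" if J: "J \<in> B" for J
    proof (rule ccontr)
      assume ne: "2 * h J \<noteq> l + 1 + t"
      \<comment> \<open>Members with traces of complementary sizes bound each other strictly, in both directions.\<close>
      define C where "C i = {I\<in>B. h I = i}" for i
      have step: "t * weight w (C i) < weight w (C j)"
        if "C i \<noteq> {}" "i + j = l + 1 + t" "i \<noteq> j" for i j
      proof (rule pull)
        fix E I assume "E \<in> C i" "I \<in> F - C j"
        then show "t \<le> card (I \<inter> (E - {l}))"
          using key[of E I] that by (force simp: C_def not_le[symmetric])
      qed (use that BF in \<open>auto simp: C_def\<close>)
      have mono: "x \<le> t * x" for x :: nat using t(1) by simp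
      have "h J \<le> l + 1" using card_mono[of "{..l}" "J \<inter> {..l}"] by (simp add: h_def)
      then obtain j where j: "h J + j = l + 1 + t" by (metis le_add_diff_inverse trans_le_add1)
      have "C (h J) \<noteq> {}" using J by (auto simp: C_def)
      then have s1: "t * weight w (C (h J)) < weight w (C j)" using step j ne by auto
      then have "C j \<noteq> {}" by (auto simp: weight_def)
      then have "t * weight w (C j) < weight w (C (h J))" using step j ne by (auto simp: add.commute)
      then show False
        using s1 mono[of "weight w (C j)"] mono[of "weight w (C (h J))"] by linarith
    qed
    obtain J0 where J0: "J0 \<in> B" using Bne by blast
    define i where "i = h J0"
    have i: "2 * i = l + 1 + t" "t < i" using balanced[OF J0] h_gt J0 BF by (auto simp: i_def)
    have hi: "h J = i" if "J \<in> B" for J using balanced[OF that] i by simp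
    have cnt_in: "card {a\<in>{..<l}. a \<in> J} = i - 1"
      and cnt_out: "card {a\<in>{..<l}. a \<notin> J} = i - t" if J: "J \<in> B" for J
    proof -
      have "J \<inter> {..l} = insert l {a\<in>{..<l}. a \<in> J}" using J by (auto simp: B_def)
      then have "h J = Suc (card {a\<in>{..<l}. a \<in> J})" by (simp add: h_def)
      then show c: "card {a\<in>{..<l}. a \<in> J} = i - 1" using hi[OF J] by simp
      have "card ({a\<in>{..<l}. a \<in> J} \<union> {a\<in>{..<l}. a \<notin> J}) =
          card {a\<in>{..<l}. a \<in> J} + card {a\<in>{..<l}. a \<notin> J}"
        by (intro card_Un_disjoint) auto
      moreover have "{a\<in>{..<l}. a \<in> J} \<union> {a\<in>{..<l}. a \<notin> J} = {..<l}" by auto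
      ultimately show "card {a\<in>{..<l}. a \<notin> J} = i - t" using c i by simp
    qed
    \<comment> \<open>No set avoiding \<open>a\<close> is in conflict with another one, because together the two would have to cover \<open>a\<close>.\<close>
    define P where "P a = {J\<in>B. a \<notin> J}" for a
    define R where "R a = {J\<in>B. a \<in> J}" for a
    have strict: "t * weight w (P a) < weight w (R a)" if "a < l" "P a \<noteq> {}" for a
    proof (rule pull)
      fix E I assume E: "E \<in> P a" and I: "I \<in> F - R a"
      show "t \<le> card (I \<inter> (E - {l}))"
      proof (rule ccontr)
        assume "\<not> t \<le> card (I \<inter> (E - {l}))"
        then have "I \<in> B" "{..l} \<subseteq> I \<union> E" using key[of E I] E I by (auto simp: P_def)
        moreover have "a \<in> {..l}" using \<open>a < l\<close> by simp
        ultimately have "a \<in> I \<union> E" by blast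
        then show False using E I \<open>I \<in> B\<close> by (auto simp: P_def R_def)
      qed
    qed (use that BF in \<open>auto simp: P_def R_def\<close>)
    have double_count: "(\<Sum>a<l. weight w {J\<in>B. Q a J}) = c * weight w B"
      if "\<And>J. J \<in> B \<Longrightarrow> card {a\<in>{..<l}. Q a J} = c" for Q c
    proof -
      have "(\<Sum>a<l. weight w {J\<in>B. Q a J}) = (\<Sum>a<l. \<Sum>J\<in>B. if Q a J then w (card J) else 0)"
        unfolding weight_def using finB by (simp add: sum.inter_filter)
      also have "\<dots> = (\<Sum>J\<in>B. \<Sum>a<l. if Q a J then w (card J) else 0)" by (rule sum.swap)
      also have "\<dots> = (\<Sum>J\<in>B. c * w (card J))"
      proof (rule sum.cong[OF refl])
        fix J assume "J \<in> B"
        then show "(\<Sum>a<l. if Q a J then w (card J) else 0) = c * w (card J)"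
          using that[of J] by (simp add: sum.inter_filter[symmetric])
      qed
      finally show ?thesis by (simp add: weight_def sum_distrib_left)
    qed
    have "(\<Sum>a<l. t * weight w (P a)) < (\<Sum>a<l. weight w (R a))"
    proof (rule sum_strict_mono_ex1)
      show "\<forall>a\<in>{..<l}. t * weight w (P a) \<le> weight w (R a)"
      proof
        fix a assume "a \<in> {..<l}"
        then show "t * weight w (P a) \<le> weight w (R a)"
          using strict[of a] by (cases "P a = {}") (auto simp: weight_def)
      qed
      have "{a\<in>{..<l}. a \<notin> J0} \<noteq> {}" using cnt_out[OF J0] i by (metis card.empty zero_less_diff less_irrefl)
      then obtain a where "a < l" "a \<notin> J0" by auto
      then show "\<exists>a\<in>{..<l}. t * weight w (P a) < weight w (R a)"
        using strict[of a] J0 by (auto simp: P_def)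
    qed simp
    also have "(\<Sum>a<l. weight w (R a)) = (i - 1) * weight w B"
      unfolding R_def using cnt_in by (rule double_count)
    also have "(\<Sum>a<l. t * weight w (P a)) = t * ((i - t) * weight w B)"
      unfolding P_def sum_distrib_left[symmetric] using double_count[OF cnt_out] by simp
    \<comment> \<open>Each set of \<open>B\<close> avoids \<open>i - t\<close> of the coordinates below \<open>l\<close> and contains \<open>i - 1\<close> of them.\<close>
    finally have "t * (i - t) < i - 1" by (metis mult.assoc mult_less_cancel2)
    moreover have "i - 1 \<le> t * (i - t)"
    proof -
      obtain d where d: "i = t + 1 + d" using i(2) by (metis Suc_eq_plus1 less_iff_Suc_add add.assoc add.commute)
      have "d \<le> t * d" using t(1) by simp
      then show ?thesis by (simp add: d algebra_simps)
    qed
    ultimately show ?thesis by simp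
  qed
qed

lemma maximum_weight_is_star:
  fixes w :: "nat \<Rightarrow> nat"
  assumes t: "1 \<le> t" "t \<le> k" "t \<le> n"
    and pos: "\<And>j. j \<le> k \<Longrightarrow> 0 < w j"
    and decay: "\<And>j. t < j \<Longrightarrow> j \<le> k \<Longrightarrow> t * w j < w (j - 1)"
    and FU: "F \<subseteq> small_sets n k" and int: "t_intersecting t F"
    and max: "\<And>G. G \<subseteq> small_sets n k \<Longrightarrow> t_intersecting t G \<Longrightarrow> weight w G \<le> weight w F"
  shows "\<exists>T. card T = t \<and> F = star (small_sets n k) T"
proof (rule star_if_stable_star[where S = "{(i, j). i < j}" and r = id and w = w and M = "weight w F"])
  fix a b :: nat and X assume "(a, b) \<in> {(i, j). i < j}" and X: "X \<in> small_sets n k"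
  then show "swap_in a b X \<in> small_sets n k"
    using card_swap_in[OF finite_in_small_sets[OF X]] 
    by (auto simp: small_sets_def swap_in_def)
next
  \<comment> \<open>Sets of size below \<open>k\<close> are admitted, so \<open>T\<close> itself separates.\<close>
  fix a b :: nat and T X Y
  assume "card T = t" "b \<notin> T" "X \<in> star (small_sets n k) T"
  then show "\<exists>Z\<in>star (small_sets n k) T. b \<notin> Z \<and> X \<inter> Z \<subseteq> T \<and> Y \<inter> Z \<subseteq> T"
    by (intro bexI[of _ T]) (auto simp: star_def intro: small_sets_mono)
next
  fix G assume G: "G \<subseteq> small_sets n k" "t_intersecting t G" "weight w G = weight w F"
    "\<And>a b X. (a, b) \<in> {(i, j). i < j} \<Longrightarrow> X \<in> G \<Longrightarrow> swap_in a b X \<in> G"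
  show "\<exists>T. card T = t \<and> G = star (small_sets n k) T"
    using t pos decay G(1,2) max G(4) unfolding G(3)[symmetric]
    by (rule shifted_maximum_is_star) auto
qed (use FU int finite_small_sets finite_in_small_sets in auto)

section \<open>Partial words\<close>

text \<open>A word is represented by the graph of the partial function that its nonzero symbols form.\<close>

definition partial_words :: "nat \<Rightarrow> nat \<Rightarrow> nat \<Rightarrow> (nat \<times> nat) set set" where
  "partial_words q n k = {X. X \<subseteq> {..<n} \<times> {1..<q} \<and> inj_on fst X \<and> card X = k}"

definition ones :: "(nat \<times> nat) set \<Rightarrow> nat set" where
  "ones X = {i. (i, 1) \<in> X}"

lemma finite_partial_word: "X \<in> partial_words q n k \<Longrightarrow> finite X"
  using finite_subset[of X "{..<n} \<times> {1..<q}"] by (simp add: partial_words_def)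

lemma finite_partial_words: "finite (partial_words q n k)"
  by (rule finite_subset[of _ "Pow ({..<n} \<times> {1..<q})"]) (auto simp: partial_words_def)

text \<open>A relation that is injective in the first component is the graph of a function on its domain.\<close>

lemma graph_of_inj_fst:
  assumes "inj_on fst X"
  obtains f where "\<And>i s. (i, s) \<in> X \<longleftrightarrow> i \<in> fst ` X \<and> s = f i"
proof -
  have "\<forall>i\<in>fst ` X. \<exists>s. (i, s) \<in> X" by force
  then obtain f where f: "\<And>i. i \<in> fst ` X \<Longrightarrow> (i, f i) \<in> X" by metis
  have "(i, s) \<in> X \<longleftrightarrow> i \<in> fst ` X \<and> s = f i" for i s
  proof
    assume mem: "(i, s) \<in> X"
    then have i: "i \<in> fst ` X" by (rule rev_image_eqI) simp
    then have "(i, s) = (i, f i)" using inj_onD[OF assms _ mem f] by simp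
    then show "i \<in> fst ` X \<and> s = f i" using i by simp
  qed (use f in blast)
  then show ?thesis by (rule that)
qed

lemma ones_in_small_sets:
  assumes "X \<in> partial_words q n k"
  shows "ones X \<in> small_sets n k"
proof -
  have "(\<lambda>i. (i, 1)) ` ones X \<subseteq> X" by (auto simp: ones_def)
  then have "card ((\<lambda>i. (i, 1::nat)) ` ones X) \<le> card X"
    using finite_partial_word[OF assms] by (rule card_mono[rotated])
  then have "card (ones X) \<le> k"
    using assms by (simp add: card_image inj_on_def partial_words_def)
  then show ?thesis using assms by (auto simp: small_sets_def ones_def partial_words_def)
qed

text \<open>The remaining \<open>k - card J\<close> coordinates of the support are chosen outside \<open>J\<close>, and each carries
one of the \<open>q - 2\<close> symbols that are neither \<open>0\<close> nor \<open>1\<close>.\<close>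

lemma card_fixed_ones:
  assumes J: "J \<in> small_sets n k" and q: "2 \<le> q"
  shows "card {X \<in> partial_words q n k. ones X = J} =
    (n - card J choose (k - card J)) * (q - 2) ^ (k - card J)"
proof -
  let ?k = "k - card J"
  let ?A = "{S. S \<subseteq> {..<n} - J \<and> card S = ?k}"
  let ?B = "\<lambda>S. PiE (J \<union> S) (\<lambda>i. if i \<in> J then {1} else {2..<q})"
  let ?D = "Sigma ?A ?B"
  let ?h = "\<lambda>(S, f). (\<lambda>i. (i, f i :: nat)) ` (J \<union> S)"
  have finJ: "finite J" and Jn: "J \<subseteq> {..<n}" and Jk: "card J \<le> k"
    using J finite_in_small_sets[OF J] by (auto simp: small_sets_def)
  have finA: "finite S" if "S \<in> ?A" for S
    using that finite_subset[of S "{..<n}"] by auto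
  have "bij_betw ?h ?D {X \<in> partial_words q n k. ones X = J}"
  proof (rule bij_betw_imageI)
    show "inj_on ?h ?D"
    proof (rule inj_onI)
      fix a b assume ab: "a \<in> ?D" "b \<in> ?D" "?h a = ?h b"
      obtain S f S' f' where eq: "a = (S, f)" "b = (S', f')" by (metis surj_pair)
      have gr: "(\<lambda>i. (i, f i)) ` (J \<union> S) = (\<lambda>i. (i, f' i)) ` (J \<union> S')"
        using ab(3) unfolding eq prod.case .
      from arg_cong[OF gr, of "image fst"] have JS: "J \<union> S = J \<union> S'"
        by (simp add: image_image)
      have "J \<inter> S = {}" "J \<inter> S' = {}" using ab(1,2) unfolding eq by auto
      then have S: "S = S'" using JS by blast
      have "f i = f' i" if "i \<in> J \<union> S" for i
      proof -
        have "(i, f i) \<in> (\<lambda>i. (i, f' i)) ` (J \<union> S')" using gr that by blast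
        then show ?thesis by auto
      qed
      moreover have "f \<in> ?B S" "f' \<in> ?B S" using ab(1,2) unfolding eq S by auto
      ultimately have "f = f'" by (intro PiE_ext)
      then show "a = b" using S eq by simp
    qed
    show "?h ` ?D = {X \<in> partial_words q n k. ones X = J}"
    proof (intro equalityI subsetI)
      fix X assume "X \<in> ?h ` ?D"
      then obtain S f where X: "X = (\<lambda>i. (i, f i)) ` (J \<union> S)" and S: "S \<in> ?A"
        and f: "f \<in> ?B S" by auto
      have f1: "f i = 1" if "i \<in> J" for i using PiE_mem[OF f, of i] that by simp
      have f2: "2 \<le> f i \<and> f i < q" if "i \<in> S" for i
        using PiE_mem[OF f, of i] that S by (auto split: if_splits)
      have "card X = card (J \<union> S)" unfolding X by (simp add: card_image inj_on_def)
      also have "\<dots> = card J + card S"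
        using S finA[OF S] finJ by (intro card_Un_disjoint) auto
      finally have "card X = k" using S Jk by simp
      moreover have "inj_on fst X" unfolding X by (auto simp: inj_on_def)
      moreover have "(i, f i) \<in> {..<n} \<times> {1..<q}" if "i \<in> J \<union> S" for i
        using that
      proof
        assume "i \<in> J"
        then show ?thesis using f1[of i] Jn q by auto
      next
        assume "i \<in> S"
        then show ?thesis using f2[of i] S by auto
      qed
      then have "X \<subseteq> {..<n} \<times> {1..<q}" unfolding X by (rule image_subsetI)
      moreover have "ones X = J"
      proof (intro equalityI subsetI)
        fix i assume "i \<in> ones X"
        then have "i \<in> J \<union> S" "f i = 1" unfolding X ones_def by auto
        then show "i \<in> J" using f2[of i] by auto
      next
        fix i assume "i \<in> J"
        then show "i \<in> ones X" using f1[of i] unfolding X ones_def by (auto intro: image_eqI[of _ _ i])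
      qed
      ultimately show "X \<in> {X \<in> partial_words q n k. ones X = J}"
        by (simp add: partial_words_def)
    next
      fix X assume "X \<in> {X \<in> partial_words q n k. ones X = J}"
      then have X: "X \<subseteq> {..<n} \<times> {1..<q}" "inj_on fst X" "card X = k" "ones X = J"
        by (auto simp: partial_words_def)
      obtain f where f: "\<And>i s. (i, s) \<in> X \<longleftrightarrow> i \<in> fst ` X \<and> s = f i"
        using graph_of_inj_fst[OF X(2)] by blast
      define S where "S = fst ` X - J"
      define g where "g = restrict f (fst ` X)"
      have JX: "J \<subseteq> fst ` X" using X(4) by (force simp: ones_def)
      have f_in: "(i, f i) \<in> X" if "i \<in> fst ` X" for i using f[of i "f i"] that by simp
      have f_eq: "f i = s" if "(i, s) \<in> X" for i s using f[of i s] that by simp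
      have "card S = card (fst ` X) - card J" unfolding S_def using finJ JX by (rule card_Diff_subset)
      also have "card (fst ` X) = k" using X(2,3) by (simp add: card_image)
      finally have SA: "S \<in> ?A" using X(1) by (auto simp: S_def)
      have fX: "fst ` X = J \<union> S" using JX by (auto simp: S_def)
      have "g i \<in> (if i \<in> J then {1} else {2..<q})" if "i \<in> J \<union> S" for i
      proof (cases "i \<in> J")
        case True
        then have "(i, 1) \<in> X" using X(4) by (auto simp: ones_def)
        then show ?thesis using f_eq True fX by (simp add: g_def)
      next
        case False
        then have "(i, f i) \<in> X" "(i, 1) \<notin> X" using X(4) f_in that fX by (auto simp: ones_def)
        then have "f i \<noteq> 1" "f i \<in> {1..<q}" using X(1) by auto
        then show ?thesis using False that fX by (auto simp: g_def)
      qed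
      then have "g \<in> ?B S" using fX by (intro PiE_I) (simp_all only: g_def restrict_apply if_False)
      then have "(S, g) \<in> ?D" using SA by blast
      moreover have "X = ?h (S, g)"
      proof -
        have "X = (\<lambda>i. (i, g i)) ` fst ` X"
        proof (intro equalityI subsetI)
          fix p assume "p \<in> X"
          then show "p \<in> (\<lambda>i. (i, g i)) ` fst ` X"
            using f[of "fst p" "snd p"] by (intro image_eqI[of _ _ "fst p"]) (auto simp: g_def prod_eq_iff)
        next
          fix p assume "p \<in> (\<lambda>i. (i, g i)) ` fst ` X"
          then obtain i where "i \<in> fst ` X" "p = (i, g i)" by blast
          then show "p \<in> X" using f_in by (simp add: g_def)
        qed
        also have "\<dots> = ?h (S, g)" unfolding fX by simp
        finally show ?thesis .
      qed
      ultimately show "X \<in> ?h ` ?D" by (rule rev_image_eqI)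
    qed
  qed
  then have "card {X \<in> partial_words q n k. ones X = J} = card ?D"
    by (rule bij_betw_same_card[symmetric])
  also have "\<dots> = (\<Sum>S\<in>?A. card (?B S))"
  proof (rule card_SigmaI)
    show "finite ?A" by (rule finite_subset[of _ "Pow {..<n}"]) auto
    show "\<forall>S\<in>?A. finite (?B S)"
    proof
      fix S assume "S \<in> ?A"
      then have "finite (J \<union> S)" using finJ finA by blast
      then show "finite (?B S)" by (rule finite_PiE) simp
    qed
  qed
  also have "\<dots> = (\<Sum>S\<in>?A. (q - 2) ^ ?k)"
  proof (rule sum.cong[OF refl])
    fix S assume S: "S \<in> ?A"
    have "card (?B S) = (\<Prod>i\<in>J \<union> S. card (if i \<in> J then {1} else {2..<q}))"
      using finJ finA[OF S] by (simp add: card_PiE)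
    also have "\<dots> = (\<Prod>i\<in>J. card (if i \<in> J then {1} else {2..<q})) *
        (\<Prod>i\<in>S. card (if i \<in> J then {1} else {2..<q}))"
      using S finJ finA[OF S] by (intro prod.union_disjoint) auto
    also have "(\<Prod>i\<in>J. card (if i \<in> J then {1} else {2..<q})) = 1" by simp
    also have "(\<Prod>i\<in>S. card (if i \<in> J then {1} else {2..<q})) = (\<Prod>i\<in>S. q - 2)"
      using S by (intro prod.cong) auto
    finally show "card (?B S) = (q - 2) ^ ?k" using S by simp
  qed
  also have "\<dots> = (n - card J choose ?k) * (q - 2) ^ ?k"
    using n_subsets[of "{..<n} - J" ?k] Jn finJ by (simp add: card_Diff_subset)
  finally show ?thesis .
qed

section \<open>Maximum families of partial words\<close>

definition ones_weight :: "nat \<Rightarrow> nat \<Rightarrow> nat \<Rightarrow> nat \<Rightarrow> nat" where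
  "ones_weight q n k j = (n - j choose (k - j)) * (q - 2) ^ (k - j)"

lemma card_ones_in:
  assumes H: "H \<subseteq> small_sets n k" and q: "2 \<le> q"
  shows "card {X \<in> partial_words q n k. ones X \<in> H} = weight (ones_weight q n k) H"
proof -
  have finH: "finite H" using H finite_small_sets by (rule finite_subset)
  have "{X \<in> partial_words q n k. ones X \<in> H} =
      (\<Union>J\<in>H. {X \<in> partial_words q n k. ones X = J})" by blast
  also have "card \<dots> = (\<Sum>J\<in>H. card {X \<in> partial_words q n k. ones X = J})"
    using finH finite_partial_words[of q n k] by (intro card_UN_disjoint) auto
  also have "\<dots> = weight (ones_weight q n k) H"
    unfolding weight_def ones_weight_def
    using H card_fixed_ones[OF _ q] by (intro sum.cong refl) blast
  finally show ?thesis .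
qed

text \<open>With \<open>N = n - j\<close> and \<open>d = k - j\<close>, the quotient of the two binomial coefficients is \<open>(N + 1) / (d + 1)\<close>,
where \<open>d + 1 \<le> k - t\<close> and \<open>N + 1 > n - k > t * (k - t)\<close>; the extra factor \<open>q - 2\<close> is at least \<open>1\<close>.\<close>

lemma ones_weight_decay:
  assumes q: "2 < q" and n: "t * (k - t) + k < n" and j: "t < j" "j \<le> k"
  shows "t * ones_weight q n k j < ones_weight q n k (j - 1)"
proof -
  define N where "N = n - j"
  define d where "d = k - j"
  have kn: "k < n" using n by simp
  have shift: "n - (j - 1) = Suc N" "k - (j - 1) = Suc d"
    using j kn by (auto simp: N_def d_def)
  have "t * Suc d \<le> t * (k - t)" using j by (intro mult_left_mono) (auto simp: d_def)
  also have "\<dots> < Suc N" using n j by (auto simp: N_def)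
  finally have less: "t * Suc d < Suc N" .
  have "0 < N choose d" using j kn by (simp add: N_def d_def)
  then have "Suc d * (t * (N choose d)) < Suc N * (N choose d)"
    using mult_strict_right_mono[OF less, of "N choose d"] by (simp only: ac_simps)
  also have "\<dots> = Suc d * (Suc N choose Suc d)" by (rule Suc_times_binomial[symmetric])
  finally have "t * (N choose d) < Suc N choose Suc d" by (metis mult_less_cancel1)
  then have "t * (N choose d) * (q - 2) ^ d < (Suc N choose Suc d) * (q - 2) ^ d"
    using q by (intro mult_strict_right_mono) auto
  also have "\<dots> \<le> (Suc N choose Suc d) * (q - 2) ^ Suc d"
    using q by (intro mult_left_mono power_increasing) auto
  finally show ?thesis
    unfolding ones_weight_def shift by (simp only: N_def d_def mult.assoc)
qed

lemma swap_in_partial_words: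
  assumes X: "X \<in> partial_words q n k" and q: "2 \<le> q"
  shows "swap_in (i, 1) (i, s) X \<in> partial_words q n k"
proof (cases "(i, s) \<in> X \<and> (i, 1) \<notin> X")
  case True
  have X': "X \<subseteq> {..<n} \<times> {1..<q}" "inj_on fst X" "card X = k"
    using X by (auto simp: partial_words_def)
  have eq: "swap_in (i, 1) (i, s) X = insert (i, 1) (X - {(i, s)})"
    using True by (simp add: swap_in_def)
  have "i \<notin> fst ` (X - {(i, s)})"
  proof
    assume "i \<in> fst ` (X - {(i, s)})"
    then obtain p where p: "p \<in> X" "p \<noteq> (i, s)" "fst p = i" by auto
    then show False using inj_onD[OF X'(2), of p "(i, s)"] True by simp
  qed
  then have "inj_on fst (swap_in (i, 1) (i, s) X)"
    unfolding eq using X'(2) by (auto simp: inj_on_diff)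
  moreover have "swap_in (i, 1) (i, s) X \<subseteq> {..<n} \<times> {1..<q}"
    unfolding eq using X'(1) True q by auto
  moreover have "card (swap_in (i, 1) (i, s) X) = k"
    using card_swap_in[OF finite_partial_word[OF X]] X'(3) by simp
  ultimately show ?thesis by (simp add: partial_words_def)
next
  case False
  then have "swap_in (i, 1) (i, s) X = X" by (auto simp: swap_in_def)
  then show ?thesis using X by simp
qed

text \<open>The supports of \<open>X\<close> and \<open>Y\<close> share the support of \<open>T\<close>, so together they have at most \<open>2 * k - t\<close> coordinates.  The hypothesis
on \<open>n\<close> leaves \<open>k - t\<close> free ones, on which \<open>T\<close> is continued.\<close>

lemma separating_partial_word:
  assumes n: "3 * k \<le> n + 2 * t" and q: "2 \<le> q" and T: "card T = t"
    and X: "X \<in> star (partial_words q n k) T" and Y: "Y \<in> star (partial_words q n k) T"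
  shows "\<exists>Z\<in>star (partial_words q n k) T. fst ` (Z - T) \<inter> fst ` X = {} \<and> fst ` (Z - T) \<inter> fst ` Y = {}"
proof -
  have XU: "X \<in> partial_words q n k" and YU: "Y \<in> partial_words q n k"
    using X Y by (auto simp: star_def)
  have X': "X \<subseteq> {..<n} \<times> {1..<q}" "inj_on fst X" "card X = k" "T \<subseteq> X" "finite X"
    using X XU finite_partial_word[OF XU] by (simp_all add: star_def partial_words_def)
  have Y': "inj_on fst Y" "card Y = k" "T \<subseteq> Y" "finite Y" "Y \<subseteq> {..<n} \<times> {1..<q}"
    using Y YU finite_partial_word[OF YU] by (simp_all add: star_def partial_words_def)
  have injT: "inj_on fst T" using X'(2,4) by (rule inj_on_subset)
  have finT: "finite T" using X'(4,5) by (rule finite_subset)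
  have tk: "t \<le> k" using card_mono[OF X'(5,4)] T X' by simp
  let ?P = "fst ` X" and ?Q = "fst ` Y"
  have cards: "card ?P = k" "card ?Q = k" "card (fst ` T) = t"
    using X' Y' injT T by (simp_all add: card_image)
  have "card (fst ` T) \<le> card (?P \<inter> ?Q)"
    using X' Y' by (intro card_mono) auto
  moreover have "card ?P + card ?Q = card (?P \<union> ?Q) + card (?P \<inter> ?Q)"
    using X' Y' by (intro card_Un_Int) auto
  ultimately have "card (?P \<union> ?Q) + t \<le> 2 * k" using cards by simp
  moreover have "card ({..<n} - (?P \<union> ?Q)) = n - card (?P \<union> ?Q)"
    using X' Y' by (subst card_Diff_subset) auto
  ultimately have "k - t \<le> card ({..<n} - (?P \<union> ?Q))" using n by linarith
  then obtain S where S: "S \<subseteq> {..<n} - (?P \<union> ?Q)" "card S = k - t" "finite S"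
    by (rule obtain_subset_with_card_n)
  define I where "I = (\<lambda>i. (i, 1::nat)) ` S"
  define Z where "Z = T \<union> I"
  have fI: "fst ` I = S" by (simp add: I_def image_image)
  have cI: "card I = k - t" "finite I" "inj_on fst I"
    using S(2,3) by (simp_all add: I_def card_image inj_on_def)
  have disj: "fst ` T \<inter> S = {}" using S(1) X'(4) by blast
  then have TI: "T \<inter> I = {}" using fI by blast
  have "card Z = k" using card_Un_disjoint[OF finT cI(2) TI] cI(1) T tk by (simp add: Z_def)
  moreover have "Z \<subseteq> {..<n} \<times> {1..<q}"
  proof -
    have "I \<subseteq> {..<n} \<times> {1..<q}" using S(1) q by (auto simp: I_def)
    then show ?thesis using X'(1,4) by (auto simp: Z_def)
  qed
  moreover have "inj_on fst Z"
  proof -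
    have "fst ` (T - I) \<inter> fst ` (I - T) = {}" using disj fI by blast
    then show ?thesis using injT cI(3) by (simp add: Z_def inj_on_Un)
  qed
  moreover have "T \<subseteq> Z" by (auto simp: Z_def)
  ultimately have "Z \<in> star (partial_words q n k) T"
    by (simp add: star_def partial_words_def)
  moreover have "fst ` (Z - T) \<subseteq> S" using fI by (auto simp: Z_def)
  then have "fst ` (Z - T) \<inter> ?P = {}" "fst ` (Z - T) \<inter> ?Q = {}" using S(1) by blast+
  ultimately show ?thesis by blast
qed

text \<open>A common pair \<open>(i, s)\<close> with \<open>s \<ge> 2\<close> of \<open>X\<close> and \<open>Y\<close> can be destroyed by changing the symbol of \<open>X\<close> at \<open>i\<close> to \<open>1\<close>, which stays in the
family and does not create a new common pair.  Iterating, the words agree in symbols \<open>1\<close> only, and still in \<open>t\<close> places.\<close>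

lemma t_intersecting_ones:
  assumes G: "G \<subseteq> partial_words q n k" and int: "t_intersecting t G"
    and stable: "\<And>i s X. \<lbrakk>i < n; 2 \<le> s; s < q; X \<in> G\<rbrakk> \<Longrightarrow> swap_in (i, 1) (i, s) X \<in> G"
    and XY: "X \<in> G" "Y \<in> G"
  shows "t \<le> card (ones X \<inter> ones Y)"
  using XY
proof (induction "card {p \<in> X \<inter> Y. snd p \<noteq> 1}" arbitrary: X rule: less_induct)
  case less
  have XU: "X \<in> partial_words q n k" and YU: "Y \<in> partial_words q n k"
    using less.prems G by auto
  have X: "X \<subseteq> {..<n} \<times> {1..<q}" "inj_on fst X" "finite X"
    and Y: "inj_on fst Y"
    using XU YU finite_partial_word[OF XU] by (simp_all add: partial_words_def)
  show ?case
  proof (cases "{p \<in> X \<inter> Y. snd p \<noteq> 1} = {}")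
    case True
    have eq: "X \<inter> Y = (\<lambda>i. (i, 1)) ` (ones X \<inter> ones Y)"
    proof (intro equalityI subsetI)
      fix p assume p: "p \<in> X \<inter> Y"
      then have "snd p = 1" using True by blast
      then have "p = (fst p, 1)" by (simp add: prod_eq_iff)
      then show "p \<in> (\<lambda>i. (i, 1)) ` (ones X \<inter> ones Y)"
        using p by (intro image_eqI[of _ _ "fst p"]) (simp_all add: ones_def)
    qed (auto simp: ones_def)
    have "card (X \<inter> Y) = card (ones X \<inter> ones Y)"
      unfolding eq by (simp add: card_image inj_on_def)
    then show ?thesis using t_intersectingD[OF int less.prems] by simp
  next
    case False
    then obtain i s where p: "(i, s) \<in> X" "(i, s) \<in> Y" "s \<noteq> 1" by auto
    have iss: "i < n" "2 \<le> s" "s < q" using p X(1) by auto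
    have no: "(i, 1) \<notin> X" "(i, 1) \<notin> Y"
      using inj_onD[OF X(2) _ p(1), of "(i, 1)"] inj_onD[OF Y _ p(2), of "(i, 1)"] p(3) by auto
    let ?X = "swap_in (i, 1) (i, s) X"
    have eq: "?X = insert (i, 1) (X - {(i, s)})" using p no by (simp add: swap_in_def)
    let ?B = "{p \<in> X \<inter> Y. snd p \<noteq> 1}"
    have "{p \<in> ?X \<inter> Y. snd p \<noteq> 1} = ?B - {(i, s)}"
      unfolding eq using no(2) by auto
    moreover have "finite ?B" by (rule finite_subset[OF _ X(3)]) blast
    then have "card (?B - {(i, s)}) < card ?B"
      by (rule card_Diff1_less) (use p in simp)
    ultimately have "card {p \<in> ?X \<inter> Y. snd p \<noteq> 1} < card ?B" by (simp only:)
    then have "t \<le> card (ones ?X \<inter> ones Y)"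
      using stable[OF iss less.prems(1)] less.prems(2) by (rule less.hyps)
    moreover have "ones ?X \<inter> ones Y = ones X \<inter> ones Y"
      unfolding eq using p(3) no by (auto simp: ones_def)
    ultimately show ?thesis by simp
  qed
qed

text \<open>Passing to the sets of ones.  The number of words with ones in a \<open>t\<close>-intersecting family of small sets is the weight of that
family, and the maximum of this weight is attained by a star, whose words again form a \<open>t\<close>-intersecting family
of words.  Hence the maxima of both problems coincide.  The family \<open>H\<close> of all small
supersets of sets of ones of \<open>G\<close> therefore has maximum weight, so that it is a star, and \<open>G\<close> consists of all words with ones in \<open>H\<close>.\<close>

lemma star_if_stable_maximum:
  assumes q: "2 < q" and t: "1 \<le> t" "t \<le> k" and n: "t * (k - t) + k < n"
    and G: "G \<subseteq> partial_words q n k" and int: "t_intersecting t G"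
    and max: "\<And>H. H \<subseteq> partial_words q n k \<Longrightarrow> t_intersecting t H \<Longrightarrow> card H \<le> card G"
    and stable: "\<And>i s X. \<lbrakk>i < n; 2 \<le> s; s < q; X \<in> G\<rbrakk> \<Longrightarrow> swap_in (i, 1) (i, s) X \<in> G"
  shows "\<exists>T. card T = t \<and> G = star (partial_words q n k) T"
proof -
  let ?w = "ones_weight q n k"
  let ?U = "small_sets n k"
  let ?lift = "\<lambda>H. {X \<in> partial_words q n k. ones X \<in> H}"
  have kn: "k < n" using n by simp
  have q2: "2 \<le> q" using q by simp
  have pos: "0 < ?w j" if "j \<le> k" for j
    using that q kn by (simp add: ones_weight_def)
  have decay: "t * ?w j < ?w (j - 1)" if "t < j" "j \<le> k" for j
    using q n that by (rule ones_weight_decay)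
  have lift_star: "?lift (star ?U T) = star (partial_words q n k) ((\<lambda>i. (i, 1)) ` T)" for T
    using ones_in_small_sets by (auto simp: star_def ones_def)
  have is_star: "\<exists>T. card T = t \<and> H = star ?U T"
    if "H \<subseteq> ?U" "t_intersecting t H"
      "\<And>H'. H' \<subseteq> ?U \<Longrightarrow> t_intersecting t H' \<Longrightarrow> weight ?w H' \<le> weight ?w H" for H
    using t(1,2) _ pos decay that by (rule maximum_weight_is_star) (use t kn in simp)
  have bound: "weight ?w H \<le> card G" if H: "H \<subseteq> ?U" "t_intersecting t H" for H
  proof -
    let ?HH = "{H. H \<subseteq> ?U \<and> t_intersecting t H}"
    have "finite ?HH" using finite_small_sets[of n k] by simp
    then have fin: "finite (weight ?w ` ?HH)" by simp
    then have "Max (weight ?w ` ?HH) \<in> weight ?w ` ?HH" using H by (intro Max_in) auto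
    then obtain H0 where H0: "H0 \<in> ?HH" "Max (weight ?w ` ?HH) = weight ?w H0" by blast
    have H0_max: "weight ?w H' \<le> weight ?w H0" if "H' \<subseteq> ?U" "t_intersecting t H'" for H'
      unfolding H0(2)[symmetric] using fin that by (intro Max_ge) auto
    obtain T where T: "card T = t" "H0 = star ?U T"
      using is_star[of H0] H0(1) H0_max by blast
    have "t_intersecting (card ((\<lambda>i. (i, 1::nat)) ` T)) (?lift H0)"
      unfolding T(2) lift_star using finite_partial_word by (rule t_intersecting_star)
    then have "t_intersecting t (?lift H0)" using T(1) by (simp add: card_image inj_on_def)
    then have "card (?lift H0) \<le> card G" by (intro max) auto
    then show ?thesis
      using card_ones_in[of H0 n k q] H0(1) q2 H0_max[OF H] by simp
  qed
  define H where "H = {J \<in> ?U. \<exists>X\<in>G. ones X \<subseteq> J}"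
  have HU: "H \<subseteq> ?U" by (auto simp: H_def)
  have intH: "t_intersecting t H"
    unfolding t_intersecting_def
  proof (intro ballI)
    fix I J assume "I \<in> H" "J \<in> H"
    then obtain X Y where XY: "X \<in> G" "Y \<in> G" "ones X \<subseteq> I" "ones Y \<subseteq> J" and I: "I \<in> ?U"
      unfolding H_def by blast
    have "t \<le> card (ones X \<inter> ones Y)"
      using G int stable XY(1,2) by (rule t_intersecting_ones)
    also have "\<dots> \<le> card (I \<inter> J)"
      using XY finite_in_small_sets[OF I] by (intro card_mono) auto
    finally show "t \<le> card (I \<inter> J)" .
  qed
  have sub: "G \<subseteq> ?lift H"
    using G ones_in_small_sets by (auto simp: H_def)
  have fin: "finite (?lift H)" using finite_partial_words[of q n k] by simp
  have ge: "card G \<le> weight ?w H"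
    using card_mono[OF fin sub] card_ones_in[OF HU q2] by simp
  then have "weight ?w H' \<le> weight ?w H" if "H' \<subseteq> ?U" "t_intersecting t H'" for H'
    using bound[OF that] by simp
  then obtain T where T: "card T = t" "H = star ?U T" using is_star[OF HU intH] by blast
  have "G = ?lift H"
    using fin sub card_ones_in[OF HU q2] bound[OF HU intH] by (intro card_seteq) auto
  then have "G = star (partial_words q n k) ((\<lambda>i. (i, 1)) ` T)"
    unfolding T(2) lift_star .
  moreover have "card ((\<lambda>i. (i, 1::nat)) ` T) = t" using T(1) by (simp add: card_image inj_on_def)
  ultimately show ?thesis by blast
qed

text \<open>Here the allowed shifts replace a symbol \<open>s \<ge> 2\<close> by \<open>1\<close>, and constant weights make the weight of a family its size.\<close>

theorem maximum_partial_words_is_star: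
  assumes q: "2 < q" and t: "1 \<le> t" "t \<le> k"
    and n: "t * (k - t) + k < n" "3 * k \<le> n + 2 * t"
    and F: "F \<subseteq> partial_words q n k" and int: "t_intersecting t F"
    and max: "\<And>G. G \<subseteq> partial_words q n k \<Longrightarrow> t_intersecting t G \<Longrightarrow> card G \<le> card F"
  shows "\<exists>T. card T = t \<and> F = star (partial_words q n k) T"
proof (rule star_if_stable_star[where S = "{((i, 1), (i, s)) |i s. i < n \<and> 2 \<le> s \<and> s < q}"
      and r = snd and w = "\<lambda>_. 1" and M = "card F"])
  fix a b :: "nat \<times> nat" and T X Y
  assume ab: "(a, b) \<in> {((i, 1), (i, s)) |i s. i < n \<and> 2 \<le> s \<and> s < q}"
    and T: "card T = t" "a \<in> T" "b \<notin> T"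
    and X: "X \<in> star (partial_words q n k) T" and Y: "Y \<in> star (partial_words q n k) T"
  obtain Z where Z: "Z \<in> star (partial_words q n k) T"
    "fst ` (Z - T) \<inter> fst ` X = {}" "fst ` (Z - T) \<inter> fst ` Y = {}"
    using separating_partial_word[OF n(2) _ T(1) X Y] q by auto
  have "b \<notin> Z"
  proof
    assume "b \<in> Z"
    then have "fst b \<in> fst ` (Z - T)" using T(3) by blast
    moreover have "fst b = fst a" using ab by auto
    moreover have "fst a \<in> fst ` X" using T(2) X by (auto simp: star_def)
    ultimately show False using Z(2) by auto
  qed
  moreover have "X \<inter> Z \<subseteq> T" "Y \<inter> Z \<subseteq> T" using Z by blast+
  ultimately show "\<exists>Z\<in>star (partial_words q n k) T. b \<notin> Z \<and> X \<inter> Z \<subseteq> T \<and> Y \<inter> Z \<subseteq> T"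
    using Z(1) by blast
next
  fix G assume G: "G \<subseteq> partial_words q n k" "t_intersecting t G" "weight (\<lambda>_. 1) G = card F"
    "\<And>a b X. (a, b) \<in> {((i, 1), (i, s)) |i s. i < n \<and> 2 \<le> s \<and> s < q} \<Longrightarrow> X \<in> G \<Longrightarrow>
      swap_in a b X \<in> G"
  have "card G = card F" using G(3) by (simp add: weight_def)
  then show "\<exists>T. card T = t \<and> G = star (partial_words q n k) T"
    using q t n(1) G(1,2) max G(4) by (intro star_if_stable_maximum) auto
next
  fix a b :: "nat \<times> nat" and X
  assume "(a, b) \<in> {((i, 1), (i, s)) |i s. i < n \<and> 2 \<le> s \<and> s < q}" "X \<in> partial_words q n k"
  then show "swap_in a b X \<in> partial_words q n k"
    using swap_in_partial_words q by auto
qed (use F int finite_partial_word finite_partial_words in \<open>auto simp: weight_def\<close>)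

section \<open>Words as partial words\<close>

definition weight_words :: "nat \<Rightarrow> nat \<Rightarrow> nat \<Rightarrow> nat list set" where
  "weight_words q k n = {x \<in> words q n. wt x = k}"

definition graph_of :: "nat list \<Rightarrow> (nat \<times> nat) set" where
  "graph_of x = {(i, s). i < length x \<and> x ! i = s \<and> s \<noteq> 0}"

lemma length_weight_words: "x \<in> weight_words q k n \<Longrightarrow> length x = n"
  by (simp add: weight_words_def words_def)

lemma nth_weight_words: "x \<in> weight_words q k n \<Longrightarrow> i < n \<Longrightarrow> x ! i < q"
  using nth_mem by (fastforce simp: weight_words_def words_def)

lemma in_weight_wordsI:
  assumes "length x = n" "\<And>i. i < n \<Longrightarrow> x ! i < q" "card {i. i < n \<and> x ! i \<noteq> 0} = k"
  shows "x \<in> weight_words q k n"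
  using assms by (auto simp: weight_words_def words_def wt_def in_set_conv_nth)

lemma wt_weight_words: "x \<in> weight_words q k n \<Longrightarrow> card {i. i < n \<and> x ! i \<noteq> 0} = k"
  by (auto simp: weight_words_def words_def wt_def)

lemma graph_of_eq_image: "graph_of x = (\<lambda>i. (i, x ! i)) ` {i. i < length x \<and> x ! i \<noteq> 0}"
  by (auto simp: graph_of_def)

lemma card_graph_of_Int:
  assumes "length x = n" "length y = n"
  shows "card (graph_of x \<inter> graph_of y) = card {i. i < n \<and> x ! i = y ! i \<and> x ! i \<noteq> 0}"
proof -
  have "graph_of x \<inter> graph_of y = (\<lambda>i. (i, x ! i)) ` {i. i < n \<and> x ! i = y ! i \<and> x ! i \<noteq> 0}"
    using assms by (auto simp: graph_of_def)
  then show ?thesis by (simp add: card_image inj_on_def)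
qed

lemma inj_on_graph_of: "inj_on graph_of (weight_words q k n)"
proof (rule inj_onI)
  fix x y assume xy: "x \<in> weight_words q k n" "y \<in> weight_words q k n" "graph_of x = graph_of y"
  note len = length_weight_words[OF xy(1)] length_weight_words[OF xy(2)]
  show "x = y"
  proof (rule nth_equalityI)
    fix i assume i: "i < length x"
    have "(i, s) \<in> graph_of x \<longleftrightarrow> (i, s) \<in> graph_of y" for s using xy(3) by simp
    from this[of "x ! i"] this[of "y ! i"] show "x ! i = y ! i"
      using i len by (auto simp: graph_of_def)
  qed (simp add: len)
qed

lemma graph_of_in_partial_words:
  assumes "x \<in> weight_words q k n"
  shows "graph_of x \<in> partial_words q n k"
proof -
  have "card (graph_of x) = k"
    using wt_weight_words[OF assms] length_weight_words[OF assms]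
    by (simp add: graph_of_eq_image card_image inj_on_def)
  moreover have "graph_of x \<subseteq> {..<n} \<times> {1..<q}"
    using nth_weight_words[OF assms] length_weight_words[OF assms] by (auto simp: graph_of_def)
  moreover have "inj_on fst (graph_of x)" by (auto simp: graph_of_def inj_on_def)
  ultimately show ?thesis by (simp add: partial_words_def)
qed

lemma graph_of_weight_words:
  assumes q: "0 < q"
  shows "graph_of ` weight_words q k n = partial_words q n k"
proof (intro equalityI subsetI)
  fix X assume "X \<in> partial_words q n k"
  then have X: "X \<subseteq> {..<n} \<times> {1..<q}" "inj_on fst X" "card X = k"
    by (auto simp: partial_words_def)
  obtain f where f: "\<And>i s. (i, s) \<in> X \<longleftrightarrow> i \<in> fst ` X \<and> s = f i"
    using graph_of_inj_fst[OF X(2)] by blast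
  define x where "x = map (\<lambda>i. if i \<in> fst ` X then f i else 0) [0..<n]"
  have f_val: "i < n \<and> 1 \<le> f i \<and> f i < q" if "i \<in> fst ` X" for i
  proof -
    have "(i, f i) \<in> X" using f[of i "f i"] that by simp
    then show ?thesis using X(1) by auto
  qed
  have len: "length x = n" by (simp add: x_def)
  have nth: "x ! i = (if i \<in> fst ` X then f i else 0)" if "i < n" for i
    using that by (simp add: x_def)
  have supp: "{i. i < n \<and> x ! i \<noteq> 0} = fst ` X"
    using nth f_val by (force split: if_splits)
  have "x \<in> weight_words q k n"
  proof (rule in_weight_wordsI[OF len])
    show "x ! i < q" if "i < n" for i using nth[OF that] f_val[of i] q by simp
    show "card {i. i < n \<and> x ! i \<noteq> 0} = k" unfolding supp using X(2,3) by (simp add: card_image)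
  qed
  moreover have "graph_of x = X"
  proof -
    have "(i, s) \<in> graph_of x \<longleftrightarrow> (i, s) \<in> X" for i s
    proof (cases "i \<in> fst ` X")
      case True
      then show ?thesis
        using nth[of i] f_val[of i] f[of i s] len by (cases "s = f i") (simp_all add: graph_of_def)
    next
      case False
      then show ?thesis using nth[of i] f[of i s] len
        by (cases "i < n"; cases "s = 0") (simp_all add: graph_of_def)
    qed
    then show ?thesis by auto
  qed
  ultimately show "X \<in> graph_of ` weight_words q k n" by blast
qed (use graph_of_in_partial_words in blast)

lemma intersecting_family_iff:
  "intersecting_family q t k n A \<longleftrightarrow>
     A \<subseteq> weight_words q k n \<and> t_intersecting t (graph_of ` A)"
proof -
  have "t_intersecting t (graph_of ` A) \<longleftrightarrow>
      (\<forall>x\<in>A. \<forall>y\<in>A. t \<le> card {i. i < n \<and> x ! i = y ! i \<and> x ! i \<noteq> 0})"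
    if A: "A \<subseteq> weight_words q k n"
  proof -
    have "length x = n" if "x \<in> A" for x using that A length_weight_words by blast
    then show ?thesis by (simp add: t_intersecting_def card_graph_of_Int)
  qed
  then show ?thesis unfolding intersecting_family_def weight_words_def by blast
qed

lemma canonical_family_eq:
  assumes "t \<le> k" "k \<le> n" "1 < q"
  shows "canonical_family q t k n = {y \<in> weight_words q k n. \<forall>i<t. y ! i = 1}"
proof -
  have wt: "wt x = length (filter (\<lambda>s. s \<noteq> 0) x)" for x
    by (simp add: wt_def length_filter_conv_card)
  show ?thesis
  proof (intro equalityI subsetI)
    fix y assume "y \<in> canonical_family q t k n"
    then obtain b where y: "y = replicate t 1 @ b" and b: "b \<in> words q (n - t)" "wt b = k - t"
      by (auto simp: canonical_family_def)
    have "y \<in> words q n" using b assms by (auto simp: y words_def)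
    moreover have "wt y = k" using b(2) assms unfolding y wt by simp
    ultimately show "y \<in> {y \<in> weight_words q k n. \<forall>i<t. y ! i = 1}"
      by (simp add: weight_words_def y nth_append)
  next
    fix y assume "y \<in> {y \<in> weight_words q k n. \<forall>i<t. y ! i = 1}"
    then have len: "length y = n" and set: "set y \<subseteq> {..<q}" and k: "wt y = k"
      and one: "\<And>i. i < t \<Longrightarrow> y ! i = 1"
      by (auto simp: weight_words_def words_def)
    have "take t y = replicate t 1"
      using len assms one by (intro nth_equalityI) auto
    then have y: "y = replicate t 1 @ drop t y" by (metis append_take_drop_id)
    have "wt (drop t y) = k - t" using k unfolding wt by (subst (asm) y) simp
    moreover have "drop t y \<in> words q (n - t)"
      using len set set_drop_subset[of t y] by (auto simp: words_def)
    ultimately show "y \<in> canonical_family q t k n"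
      unfolding canonical_family_def using y by blast
  qed
qed

text \<open>The maps in the definition of equivalence.\<close>

definition relabel :: "nat \<Rightarrow> (nat \<Rightarrow> nat) \<Rightarrow> (nat \<Rightarrow> nat \<Rightarrow> nat) \<Rightarrow> nat list \<Rightarrow> nat list" where
  "relabel n \<pi> \<sigma> x = map (\<lambda>i. \<sigma> i (x ! \<pi> i)) [0..<n]"

lemma relabel_in_weight_words:
  assumes \<pi>: "\<pi> permutes {..<n}" and \<sigma>: "\<And>i. i < n \<Longrightarrow> \<sigma> i permutes {..<q} \<and> \<sigma> i 0 = 0"
    and x: "x \<in> weight_words q k n"
  shows "relabel n \<pi> \<sigma> x \<in> weight_words q k n"
proof (rule in_weight_wordsI)
  have \<pi>_less: "\<pi> i < n \<longleftrightarrow> i < n" for i using permutes_in_image[OF \<pi>, of i] by simp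
  show "length (relabel n \<pi> \<sigma> x) = n" by (simp add: relabel_def)
  show "relabel n \<pi> \<sigma> x ! i < q" if i: "i < n" for i
  proof -
    have "x ! \<pi> i < q" using nth_weight_words[OF x] i \<pi>_less by simp
    then show ?thesis
      using permutes_in_image[of "\<sigma> i" "{..<q}" "x ! \<pi> i"] \<sigma>[OF i] i by (simp add: relabel_def)
  qed
  have "0 < \<sigma> i s \<longleftrightarrow> 0 < s" if "i < n" for i s
    using \<sigma>[OF that] permutes_inj by (metis injD gr0I less_irrefl)
  then have "{i. i < n \<and> relabel n \<pi> \<sigma> x ! i \<noteq> 0} = {i. i < n \<and> x ! \<pi> i \<noteq> 0}"
    by (auto simp: relabel_def)
  moreover have "\<pi> ` {i. i < n \<and> x ! \<pi> i \<noteq> 0} = {j. j < n \<and> x ! j \<noteq> 0}"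
  proof (intro equalityI subsetI)
    fix j assume j: "j \<in> {j. j < n \<and> x ! j \<noteq> 0}"
    obtain i where i: "j = \<pi> i" using permutes_surj[OF \<pi>] by (metis surjD)
    then show "j \<in> \<pi> ` {i. i < n \<and> x ! \<pi> i \<noteq> 0}" using j \<pi>_less by simp
  qed (use \<pi>_less in auto)
  then have "card {i. i < n \<and> x ! \<pi> i \<noteq> 0} = card {j. j < n \<and> x ! j \<noteq> 0}"
    using card_image[OF inj_on_subset[OF permutes_inj[OF \<pi>] subset_UNIV]] by metis
  ultimately show "card {i. i < n \<and> relabel n \<pi> \<sigma> x ! i \<noteq> 0} = k"
    using wt_weight_words[OF x] by simp
qed

lemma inj_on_relabel:
  assumes \<pi>: "\<pi> permutes {..<n}" and \<sigma>: "\<And>i. i < n \<Longrightarrow> \<sigma> i permutes {..<q} \<and> \<sigma> i 0 = 0"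
  shows "inj_on (relabel n \<pi> \<sigma>) (weight_words q k n)"
proof (rule inj_onI)
  fix x y assume xy: "x \<in> weight_words q k n" "y \<in> weight_words q k n"
    and eq: "relabel n \<pi> \<sigma> x = relabel n \<pi> \<sigma> y"
  note len = length_weight_words[OF xy(1)] length_weight_words[OF xy(2)]
  show "x = y"
  proof (rule nth_equalityI)
    fix j assume j: "j < length x"
    obtain i where i: "j = \<pi> i" using permutes_surj[OF \<pi>] by (metis surjD)
    then have "i < n" using permutes_in_image[OF \<pi>, of i] j len by simp
    moreover from this have "relabel n \<pi> \<sigma> x ! i = relabel n \<pi> \<sigma> y ! i" using eq by simp
    ultimately have "\<sigma> i (x ! j) = \<sigma> i (y ! j)" by (simp add: relabel_def i)
    then show "x ! j = y ! j" using \<sigma>[OF \<open>i < n\<close>] permutes_inj by (metis injD)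
  qed (simp add: len)
qed

lemma equivalent_card_eq:
  assumes "A \<subseteq> weight_words q k n" "equivalent q n A B"
  shows "card A = card B"
proof -
  obtain \<pi> \<sigma> where \<pi>: "\<pi> permutes {..<n}" and \<sigma>: "\<And>i. i < n \<Longrightarrow> \<sigma> i permutes {..<q} \<and> \<sigma> i 0 = 0"
    and B: "B = relabel n \<pi> \<sigma> ` A"
    using assms(2) unfolding equivalent_def relabel_def[abs_def] by blast
  show ?thesis
    unfolding B using inj_on_subset[OF inj_on_relabel[OF \<pi> \<sigma>] assms(1)] by (simp add: card_image)
qed

lemma permutes_onto_positions:
  assumes "P \<subseteq> {..<n}" "card P = t"
  obtains \<pi> where "\<pi> permutes {..<n}" "\<pi> ` {..<t} = P"
proof -
  have finP: "finite P" using assms(1) finite_subset by blast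
  have tn: "t \<le> n" using card_mono[OF _ assms(1)] assms(2) by simp
  obtain e where e: "bij_betw e {..<t} P"
    using ex_bij_betw_nat_finite[OF finP] assms(2) by (auto simp: atLeast0LessThan)
  have "card {t..<n} = card ({..<n} - P)"
    using assms finP by (simp add: card_Diff_subset)
  then obtain e' where e': "bij_betw e' {t..<n} ({..<n} - P)"
    using finite_same_card_bij by blast
  define \<pi> where "\<pi> i = (if i < t then e i else if i < n then e' i else i)" for i
  have 1: "bij_betw \<pi> {..<t} P"
    using e by (rule bij_betw_cong[THEN iffD1, rotated]) (simp add: \<pi>_def)
  have 2: "bij_betw \<pi> {t..<n} ({..<n} - P)"
    using e' by (rule bij_betw_cong[THEN iffD1, rotated]) (simp add: \<pi>_def)
  have "bij_betw \<pi> ({..<t} \<union> {t..<n}) (P \<union> ({..<n} - P))"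
    using 1 2 by (rule bij_betw_combine) blast
  moreover have "{..<t} \<union> {t..<n} = {..<n}" "P \<union> ({..<n} - P) = {..<n}"
    using tn assms(1) by auto
  ultimately have "bij_betw \<pi> {..<n} {..<n}" by simp
  then have "\<pi> permutes {..<n}"
    by (rule bij_imp_permutes) (use tn in \<open>simp add: \<pi>_def\<close>)
  moreover have "\<pi> ` {..<t} = P" using 1 by (rule bij_betw_imp_surj_on)
  ultimately show ?thesis by (rule that)
qed

text \<open>A permutation of the coordinates brings the support of \<open>T\<close> to the front, and a transposition in each of
the first \<open>t\<close> coordinates turns the symbol prescribed by \<open>T\<close> into \<open>1\<close>.  The inverse of this map is again of the
same form, which gives surjectivity.\<close>

lemma star_equivalent_canonical:
  assumes q: "1 < q" and tk: "t \<le> k" "k \<le> n"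
    and T: "T \<subseteq> {..<n} \<times> {1..<q}" "inj_on fst T" "card T = t"
  shows "equivalent q n {x \<in> weight_words q k n. T \<subseteq> graph_of x} (canonical_family q t k n)"
proof -
  let ?A = "{x \<in> weight_words q k n. T \<subseteq> graph_of x}"
  have "fst ` T \<subseteq> {..<n}" "card (fst ` T) = t" using T by (auto simp: card_image)
  then obtain \<pi> where \<pi>: "\<pi> permutes {..<n}" "\<pi> ` {..<t} = fst ` T"
    by (rule permutes_onto_positions)
  obtain v where v: "\<And>i s. (i, s) \<in> T \<longleftrightarrow> i \<in> fst ` T \<and> s = v i"
    using graph_of_inj_fst[OF T(2)] by blast
  have tn: "t \<le> n" using tk by simp
  have \<pi>T: "(\<pi> i, v (\<pi> i)) \<in> T" if "i < t" for i
    using v[of "\<pi> i" "v (\<pi> i)"] \<pi>(2) that by blast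
  have v_range: "1 \<le> v (\<pi> i)" "v (\<pi> i) < q" if "i < t" for i
    using \<pi>T[OF that] T(1) by auto
  define \<sigma> where "\<sigma> i = (if i < t then transpose 1 (v (\<pi> i)) else id)" for i
  have \<sigma>: "\<sigma> i permutes {..<q} \<and> \<sigma> i 0 = 0" for i
    using v_range[of i] q by (auto simp: \<sigma>_def permutes_id intro: permutes_swap_id transpose_apply_other)
  have \<sigma>\<sigma>: "\<sigma> i (\<sigma> i s) = s" for i s by (simp add: \<sigma>_def)
  have \<pi>_less: "\<pi> i < n \<longleftrightarrow> i < n" for i using permutes_in_image[OF \<pi>(1), of i] by simp
  have "relabel n \<pi> \<sigma> ` ?A = canonical_family q t k n"
    unfolding canonical_family_eq[OF tk q]
  proof (intro equalityI subsetI)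
    fix y assume "y \<in> relabel n \<pi> \<sigma> ` ?A"
    then obtain x where x: "x \<in> weight_words q k n" "T \<subseteq> graph_of x" and y: "y = relabel n \<pi> \<sigma> x"
      by blast
    have "y ! i = 1" if i: "i < t" for i
    proof -
      have "x ! \<pi> i = v (\<pi> i)" using \<pi>T[OF i] x(2) by (auto simp: graph_of_def)
      then show ?thesis using i tn by (simp add: y relabel_def \<sigma>_def)
    qed
    then show "y \<in> {y \<in> weight_words q k n. \<forall>i<t. y ! i = 1}"
      using relabel_in_weight_words[OF \<pi>(1) \<sigma> x(1)] y by simp
  next
    fix y assume "y \<in> {y \<in> weight_words q k n. \<forall>i<t. y ! i = 1}"
    then have y: "y \<in> weight_words q k n" and one: "\<And>i. i < t \<Longrightarrow> y ! i = 1" by auto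
    define x where "x = relabel n (inv \<pi>) (\<lambda>j. \<sigma> (inv \<pi> j)) y"
    have x: "x \<in> weight_words q k n"
      unfolding x_def using permutes_inv[OF \<pi>(1)] \<sigma> y by (rule relabel_in_weight_words)
    have nth: "x ! \<pi> i = \<sigma> i (y ! i)" if "i < n" for i
      using that \<pi>_less[of i] by (simp add: x_def relabel_def permutes_inverses(2)[OF \<pi>(1)])
    have "relabel n \<pi> \<sigma> x = y"
      by (rule nth_equalityI) (simp_all add: relabel_def nth \<sigma>\<sigma> length_weight_words[OF y])
    moreover have "T \<subseteq> graph_of x"
    proof
      fix p assume p: "p \<in> T"
      then have "fst p \<in> \<pi> ` {..<t}" using \<pi>(2) by blast
      then obtain i where i: "i < t" "fst p = \<pi> i" by blast
      moreover have "snd p = v (fst p)" using v[of "fst p" "snd p"] p by simp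
      ultimately have "p = (\<pi> i, v (\<pi> i))" by (simp add: prod_eq_iff)
      moreover have "x ! \<pi> i = v (\<pi> i)" using nth[of i] i tn one[OF i(1)] by (simp add: \<sigma>_def)
      ultimately show "p \<in> graph_of x"
        using v_range[OF i(1)] i tn \<pi>_less[of i] length_weight_words[OF x] by (simp add: graph_of_def)
    qed
    ultimately show "y \<in> relabel n \<pi> \<sigma> ` ?A" using x by blast
  qed
  then show ?thesis
    unfolding equivalent_def using \<pi>(1) \<sigma> unfolding relabel_def[abs_def] by blast
qed

lemma maximum_family_equivalent_canonical:
  assumes q: "2 < q" and t: "1 \<le> t" "t \<le> k"
    and n: "t * (k - t) + k < n" "3 * k \<le> n + 2 * t"
    and A: "intersecting_family q t k n A"
    and max: "\<And>B. intersecting_family q t k n B \<Longrightarrow> card B \<le> card A"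
    and ne: "A \<noteq> {}"
  shows "equivalent q n A (canonical_family q t k n)"
proof -
  have AW: "A \<subseteq> weight_words q k n" and int: "t_intersecting t (graph_of ` A)"
    using A by (simp_all add: intersecting_family_iff)
  have cardA: "card (graph_of ` A) = card A"
    using inj_on_subset[OF inj_on_graph_of AW] by (rule card_image)
  have GU: "graph_of ` A \<subseteq> partial_words q n k" using AW graph_of_in_partial_words by blast
  have "card G \<le> card (graph_of ` A)"
    if G: "G \<subseteq> partial_words q n k" "t_intersecting t G" for G
  proof -
    have "G \<subseteq> graph_of ` weight_words q k n" using G(1) q by (simp add: graph_of_weight_words)
    then obtain B where B: "B \<subseteq> weight_words q k n" "G = graph_of ` B" by (rule subset_imageE)
    have "card G = card B"
      unfolding B(2) using inj_on_subset[OF inj_on_graph_of B(1)] by (rule card_image)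
    also have "\<dots> \<le> card A" using B G(2) by (intro max) (simp add: intersecting_family_iff)
    finally show ?thesis by (simp add: cardA)
  qed
  then obtain T where T: "card T = t" "graph_of ` A = star (partial_words q n k) T"
    using maximum_partial_words_is_star[OF q t n GU int] by blast
  have A_eq: "A = {x \<in> weight_words q k n. T \<subseteq> graph_of x}"
  proof (intro equalityI subsetI)
    fix x assume x: "x \<in> A"
    then have "graph_of x \<in> star (partial_words q n k) T" using T(2) by blast
    then show "x \<in> {x \<in> weight_words q k n. T \<subseteq> graph_of x}" using x AW by (auto simp: star_def)
  next
    fix x assume "x \<in> {x \<in> weight_words q k n. T \<subseteq> graph_of x}"
    then have x: "x \<in> weight_words q k n" "T \<subseteq> graph_of x" by auto
    then have "graph_of x \<in> graph_of ` A"
      unfolding T(2) using graph_of_in_partial_words[OF x(1)] by (simp add: star_def)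
    then show "x \<in> A" using inj_on_image_mem_iff[OF inj_on_graph_of x(1) AW] by simp
  qed
  obtain x where "x \<in> A" using ne by blast
  then have "x \<in> weight_words q k n" and Tx: "T \<subseteq> graph_of x" using A_eq by auto
  then have x: "graph_of x \<in> partial_words q n k" by (intro graph_of_in_partial_words)
  have "T \<subseteq> {..<n} \<times> {1..<q}" "inj_on fst T"
    using Tx x inj_on_subset[OF _ Tx] by (auto simp: partial_words_def)
  then show ?thesis
    using star_equivalent_canonical[of q t k n T] T(1) q t(2) n(1) A_eq by simp
qed

theorem theorem6:
  fixes n k t q :: nat
  assumes "q > 2"
    and "n \<ge> k" and "k > t" and "t \<ge> 1"
    and "n > (t + 1) * (k - t + 1)"
    and "q \<ge> t + 1"
    and "t = 1 \<Longrightarrow> n > 3 * k - 2"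
  shows "intersecting_family q t k n (canonical_family q t k n) \<and>
    (\<forall>A. intersecting_family q t k n A \<longrightarrow>
       card A \<le> card (canonical_family q t k n)) \<and>
    (\<forall>A. intersecting_family q t k n A \<longrightarrow>
       card A = card (canonical_family q t k n) \<longrightarrow>
       equivalent q n A (canonical_family q t k n))"
proof -
  let ?C = "canonical_family q t k n"
  obtain d where d: "k = t + d" "0 < d" using assms(3) less_imp_add_positive by blast
  have n1: "t * (k - t) + k < n" using assms(5) by (simp add: d(1) algebra_simps)
  have n2: "3 * k \<le> n + 2 * t"
  proof (cases "t = 1")
    case True
    then show ?thesis using assms(3,7) by simp
  next
    case False
    then have "2 * d + (d + t) \<le> t * d + (d + t)"
      using assms(4) by (intro add_right_mono mult_right_mono) auto
    also have "\<dots> \<le> n" using assms(5) by (simp add: d(1) algebra_simps)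
    finally show ?thesis by (simp add: d(1))
  qed
  have q1: "1 < q" and tk: "t \<le> k" using assms(1,3) by auto
  have C_eq: "?C = {y \<in> weight_words q k n. \<forall>i<t. y ! i = 1}"
    using tk assms(2) q1 by (rule canonical_family_eq)
  have C: "intersecting_family q t k n ?C"
    unfolding intersecting_family_def
  proof (intro conjI ballI)
    show "?C \<subseteq> {x \<in> words q n. wt x = k}" unfolding C_eq weight_words_def by blast
    fix x y assume xy: "x \<in> ?C" "y \<in> ?C"
    have "{..<t} \<subseteq> {i. i < n \<and> x ! i = y ! i \<and> x ! i \<noteq> 0}"
      using xy tk assms(2) unfolding C_eq by auto
    then have "card {..<t} \<le> card {i. i < n \<and> x ! i = y ! i \<and> x ! i \<noteq> 0}"
      by (rule card_mono[rotated]) simp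
    then show "t \<le> card {i. i < n \<and> x ! i = y ! i \<and> x ! i \<noteq> 0}" by simp
  qed
  have "?C \<noteq> {}"
  proof -
    have "replicate k 1 @ replicate (n - k) 0 \<in> ?C"
      unfolding C_eq using q1 tk assms(2)
      by (auto simp: weight_words_def words_def wt_def nth_append length_filter_conv_card[symmetric])
    then show ?thesis by blast
  qed
  let ?S = "card ` {A. intersecting_family q t k n A}"
  have "{A. intersecting_family q t k n A} \<subseteq> Pow (words q n)"
    unfolding intersecting_family_def by blast
  then have finS: "finite ?S" using finite_words[of q n] finite_subset by blast
  have equiv: "equivalent q n A ?C"
    if A: "intersecting_family q t k n A" "card A = Max ?S" for A
  proof (rule maximum_family_equivalent_canonical[OF assms(1,4) tk n1 n2 A(1)])
    show max: "card B \<le> card A" if "intersecting_family q t k n B" for B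
      unfolding A(2) using finS that by (intro Max_ge) auto
    have "0 < card ?C"
      using finite_intersecting_family[OF C] \<open>?C \<noteq> {}\<close> by (simp add: card_gt_0_iff)
    then show "A \<noteq> {}" using max[OF C] by auto
  qed
  have "Max ?S \<in> ?S" using finS C by (intro Max_in) auto
  then obtain A0 where A0: "intersecting_family q t k n A0" "card A0 = Max ?S" by auto
  have A0_words: "A0 \<subseteq> weight_words q k n" using A0(1) by (simp add: intersecting_family_iff)
  have "card ?C = Max ?S"
    using equivalent_card_eq[OF A0_words equiv[OF A0]] A0(2) by simp
  moreover have "card A \<le> Max ?S" if "intersecting_family q t k n A" for A
    using finS that by (intro Max_ge) auto
  ultimately show ?thesis using C equiv by simp
qed

end
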